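(* Suppose either (1) $X$ is a metric graph and $0<r\le\ell(X)/4$, or (2) $X$ is a geodesic space with $r(X)>0$ and $0<r\le r(X)/2$. Then the inclusions $\operatorname{Cech}(X,r/2)\hookrightarrow\operatorname{Rips}(X,r)\hookrightarrow\operatorname{Cech}(X,r)$ are homotopy equivalences.
   Context: For a metric space $X$ and $r>0$: $\operatorname{Cech}(X,r)$ is the simplicial complex with vertex set $X$ in which a finite $\sigma\subset X$ is a simplex iff $\bigcap_{a\in\sigma}B(a,r)\neq\emptyset$ ($B$ the open ball); $\operatorname{Rips}(X,r)$ has vertex set $X$ and simplices the finite subsets of diameter $<r$; weak topology. A metric graph is a finite graph with a geodesic metric; $\ell(X)$ is the length of its shortest non-contractible loop. A metric space is geodesic if any two points $x,y$ are joined by a path of length $d(x,y)$. For a geodesic space $X$, $r(X)\ge0$ is the supremum of the real numbers $r$ satisfying: (1) for all $x,y$ with $d(x,y)<2r$ there is a unique shortest geodesic from $x$ to $y$; (2) if $d(x,y),d(u,x),d(u,y)<r$ and $z$ lies on the geodesic joining $x,y$, then $d(u,z)\le\max\{d(u,x),d(u,y)\}$; (3) if $\gamma,\gamma'$ are arc-length parameterized geodesics with $\gamma(0)=\gamma'(0)$, $0\le s,s'<r$, $0\le t<1$, then $d(\gamma(ts),\gamma'(ts'))\le d(\gamma(s),\gamma'(s'))$. *)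

theory Defs
  imports "HOL-Analysis.Analysis"
begin

text \<open>Simplicial complexes on a vertex set are represented by their sets of (finite, nonempty) simplices.\<close>

definition cech_complex :: "'a metric \<Rightarrow> real \<Rightarrow> 'a set set" where
  "cech_complex m r = {\<sigma>. finite \<sigma> \<and> \<sigma> \<noteq> {} \<and> \<sigma> \<subseteq> mspace m \<and>
      (\<Inter>a\<in>\<sigma>. mball_of m a r) \<noteq> {}}"

definition rips_complex :: "'a metric \<Rightarrow> real \<Rightarrow> 'a set set" where
  "rips_complex m r = {\<sigma>. finite \<sigma> \<and> \<sigma> \<noteq> {} \<and> \<sigma> \<subseteq> mspace m \<and>
      (\<forall>a\<in>\<sigma>. \<forall>b\<in>\<sigma>. mdist m a b < r)}"

text \<open>Points of the closed geometric simplex spanned by a finite vertex set, as barycentric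
  coordinate functions.\<close>
definition simplex_points :: "'a set \<Rightarrow> ('a \<Rightarrow> real) set" where
  "simplex_points \<sigma> = {f. (\<forall>x. 0 \<le> f x) \<and> (\<forall>x. x \<notin> \<sigma> \<longrightarrow> f x = 0) \<and> sum f \<sigma> = 1}"

definition realization :: "'a set set \<Rightarrow> ('a \<Rightarrow> real) set" where
  "realization K = (\<Union>\<sigma>\<in>K. simplex_points \<sigma>)"

definition realization_topology :: "'a set set \<Rightarrow> ('a \<Rightarrow> real) topology" where
  "realization_topology K = topology (\<lambda>U. U \<subseteq> realization K \<and>
      (\<forall>\<sigma>\<in>K. openin (top_of_set (simplex_points \<sigma>)) (U \<inter> simplex_points \<sigma>)))"

definition homotopy_equivalence_map :: "'a topology \<Rightarrow> 'b topology \<Rightarrow> ('a \<Rightarrow> 'b) \<Rightarrow> bool" where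
  "homotopy_equivalence_map X Y f \<longleftrightarrow> continuous_map X Y f \<and>
     (\<exists>g. continuous_map Y X g \<and>
          homotopic_with (\<lambda>x. True) X X (g \<circ> f) id \<and>
          homotopic_with (\<lambda>x. True) Y Y (f \<circ> g) id)"

definition is_path_in :: "'a metric \<Rightarrow> (real \<Rightarrow> 'a) \<Rightarrow> bool" where
  "is_path_in m g \<longleftrightarrow> continuous_map (top_of_set {0..1}) (mtopology_of m) g"

definition curve_length :: "'a metric \<Rightarrow> (real \<Rightarrow> 'a) \<Rightarrow> real \<Rightarrow> real \<Rightarrow> ereal" where
  "curve_length m g a b = Sup {ereal (\<Sum>i<n. mdist m (g (t i)) (g (t (Suc i)))) | n t.
      t 0 = a \<and> t n = b \<and> (\<forall>i<n. t i \<le> t (Suc i))}"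

definition geodesic_space :: "'a metric \<Rightarrow> bool" where
  "geodesic_space m \<longleftrightarrow> (\<forall>x\<in>mspace m. \<forall>y\<in>mspace m. \<exists>g. is_path_in m g \<and> g 0 = x \<and> g 1 = y \<and>
      curve_length m g 0 1 = ereal (mdist m x y))"

text \<open>A finite graph (finitely many vertices, finitely many edges; loops and multiple edges allowed)
  whose edges are realised as arcs parametrised by arc length, with a geodesic metric.
  An edge is a pair (parametrisation, length).\<close>
definition metric_graph :: "'a metric \<Rightarrow> bool" where
  "metric_graph m \<longleftrightarrow> geodesic_space m \<and>
    (\<exists>V E. finite V \<and> finite (E :: ((real \<Rightarrow> 'a) \<times> real) set) \<and> V \<subseteq> mspace m \<and>
      (\<forall>(\<gamma>, L)\<in>E. 0 < L \<and> \<gamma> ` {0..L} \<subseteq> mspace m \<and> \<gamma> 0 \<in> V \<and> \<gamma> L \<in> V \<and>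
          inj_on \<gamma> {0..<L} \<and> inj_on \<gamma> {0<..L} \<and> \<gamma> ` {0<..<L} \<inter> V = {} \<and>
          (\<forall>s t. 0 \<le> s \<and> s \<le> t \<and> t \<le> L \<longrightarrow> curve_length m \<gamma> s t = ereal (t - s))) \<and>
      (\<forall>(\<gamma>, L)\<in>E. \<forall>(\<gamma>', L')\<in>E. (\<gamma>, L) \<noteq> (\<gamma>', L') \<longrightarrow>
          \<gamma> ` {0<..<L} \<inter> \<gamma>' ` {0<..<L'} = {}) \<and>
      mspace m = V \<union> (\<Union>(\<gamma>, L)\<in>E. \<gamma> ` {0..L}))"

definition contractible_loop :: "'a metric \<Rightarrow> (real \<Rightarrow> 'a) \<Rightarrow> bool" where
  "contractible_loop m g \<longleftrightarrow> (\<exists>a\<in>mspace m.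
      homotopic_with (\<lambda>h. h 0 = h 1) (top_of_set {0..1}) (mtopology_of m) g (\<lambda>_. a))"

text \<open>Length of the shortest non-contractible loop (infinity if there is none).\<close>
definition shortest_noncontractible_loop :: "'a metric \<Rightarrow> ereal" where
  "shortest_noncontractible_loop m = Inf {curve_length m g 0 1 | g.
      is_path_in m g \<and> g 0 = g 1 \<and> \<not> contractible_loop m g}"

definition geodesic_seg :: "'a metric \<Rightarrow> 'a \<Rightarrow> 'a \<Rightarrow> (real \<Rightarrow> 'a) \<Rightarrow> bool" where
  "geodesic_seg m x y \<gamma> \<longleftrightarrow> \<gamma> 0 = x \<and> \<gamma> (mdist m x y) = y \<and>
     (\<forall>s\<in>{0..mdist m x y}. \<gamma> s \<in> mspace m) \<and>
     (\<forall>s\<in>{0..mdist m x y}. \<forall>t\<in>{0..mdist m x y}. mdist m (\<gamma> s) (\<gamma> t) = \<bar>s - t\<bar>)"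

text \<open>Geodesics are identified with their restriction to the parameter interval.\<close>
definition unique_geodesic :: "'a metric \<Rightarrow> 'a \<Rightarrow> 'a \<Rightarrow> bool" where
  "unique_geodesic m x y \<longleftrightarrow> (\<exists>\<gamma>. geodesic_seg m x y \<gamma>) \<and>
     (\<forall>\<gamma> \<gamma>'. geodesic_seg m x y \<gamma> \<and> geodesic_seg m x y \<gamma>' \<longrightarrow>
        (\<forall>s\<in>{0..mdist m x y}. \<gamma> s = \<gamma>' s))"

definition isometric_on :: "'a metric \<Rightarrow> (real \<Rightarrow> 'a) \<Rightarrow> real \<Rightarrow> bool" where
  "isometric_on m \<gamma> s \<longleftrightarrow> (\<forall>a\<in>{0..s}. \<gamma> a \<in> mspace m) \<and>
     (\<forall>a\<in>{0..s}. \<forall>b\<in>{0..s}. mdist m (\<gamma> a) (\<gamma> b) = \<bar>a - b\<bar>)"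

definition convexity_conditions :: "'a metric \<Rightarrow> real \<Rightarrow> bool" where
  "convexity_conditions m \<rho> \<longleftrightarrow>
    (\<forall>x\<in>mspace m. \<forall>y\<in>mspace m. mdist m x y < 2 * \<rho> \<longrightarrow> unique_geodesic m x y) \<and>
    (\<forall>x\<in>mspace m. \<forall>y\<in>mspace m. \<forall>u\<in>mspace m. \<forall>z \<gamma>.
        mdist m x y < \<rho> \<and> mdist m u x < \<rho> \<and> mdist m u y < \<rho> \<and>
        geodesic_seg m x y \<gamma> \<and> z \<in> \<gamma> ` {0..mdist m x y} \<longrightarrow>
        mdist m u z \<le> max (mdist m u x) (mdist m u y)) \<and>
    (\<forall>\<gamma> \<gamma>' s s' t. isometric_on m \<gamma> s \<and> isometric_on m \<gamma>' s' \<and> \<gamma> 0 = \<gamma>' 0 \<and>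
        0 \<le> s \<and> s < \<rho> \<and> 0 \<le> s' \<and> s' < \<rho> \<and> 0 \<le> t \<and> t < 1 \<longrightarrow>
        mdist m (\<gamma> (t * s)) (\<gamma>' (t * s')) \<le> mdist m (\<gamma> s) (\<gamma>' s'))"

definition convexity_radius :: "'a metric \<Rightarrow> ereal" where
  "convexity_radius m = Sup {ereal \<rho> | \<rho>. convexity_conditions m \<rho>}"

end

(* For each inclusion K of L, a retraction of |L| onto |K| is built by induction over the
   simplices s of L. Its values on s lie over vertices in the hull of s, the intersection of all
   r-balls containing s, and it extends from the boundary to s because geodesic contraction towards
   a vertex of s makes the finite subcomplexes of K over the hull null-homotopic there. Since the
   hull spans a full simplex of L, the retraction is linearly homotopic to the identity.

   This needs only short geodesics, convex balls of radius r, and nonexpansive contraction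
   inside such balls. A positive convexity radius gives these at once. In a metric graph, a
   geodesic triangle of perimeter less than the length of any non-contractible loop has each side
   covered by the other two: otherwise collapsing the complement of a small arc maps the perimeter
   to a loop of degree one in the circle. So the balls of radius r are trees. *)
theory Submission
  imports Defs
begin

section \<open>Realizations\<close>

text \<open>The weak topology on a possibly infinite vertex set shapes the argument. A map into
  \<open>realization K\<close> is easily checked for continuity once its image lies over a finite
  vertex set, where the weak topology is that of the coordinates. Hence every stage of the
  construction also records, for each simplex, a finite subset of its hull bounding the image, and
  null-homotopies are asked only over finite vertex sets \<open>F\<close>, with permission to run
  through a larger finite \<open>F'\<close>. They consist of finitely many contiguous steps; the
  strict inequalities defining both complexes leave room for a positive step size. The hull is taken
  with respect to r-balls because every center that is within r of a simplex is then within r of its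
  hull, so the centers certifying simplices of the big complex serve for the hull too. The constants
  come from one estimate: two points of an r-ball are less than 2r apart. A triangle formed by them
  and the center has perimeter below 4r, to be compared with the shortest non-contractible loop; in
  the other case 2r is compared with r(X) directly.\<close>

definition induced :: "'a set set \<Rightarrow> 'a set \<Rightarrow> 'a set set" where
  "induced K F = {\<tau>\<in>K. \<tau> \<subseteq> F}"

text \<open>The carrier: a point of a realization with finite simplices lies in the interior of
  exactly one simplex, namely the one on this vertex set.\<close>

definition supp :: "('a \<Rightarrow> real) \<Rightarrow> 'a set" where
  "supp x = {v. x v \<noteq> 0}"

lemma realizationI: "\<sigma> \<in> K \<Longrightarrow> x \<in> simplex_points \<sigma> \<Longrightarrow> x \<in> realization K"
  by (auto simp: realization_def)

lemma realization_mono: "K \<subseteq> L \<Longrightarrow> realization K \<subseteq> realization L"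
  by (auto simp: realization_def)

lemma finite_induced: "finite F \<Longrightarrow> finite (induced K F)"
  by (rule finite_subset[of _ "Pow F"]) (auto simp: induced_def)

lemma closed_simplex_points: "closed (simplex_points \<sigma>)"
proof -
  have c: "continuous_on UNIV (\<lambda>f::'a \<Rightarrow> real. f x)" for x
    by simp
  have "simplex_points \<sigma> = (\<Inter>x. {f. 0 \<le> f x}) \<inter> (\<Inter>x\<in>-\<sigma>. {f. f x = 0}) \<inter> {f. sum f \<sigma> = 1}"
    by (auto simp: simplex_points_def)
  moreover have "closed {f::'a \<Rightarrow> real. 0 \<le> f x}" for x
    by (intro closed_Collect_le c continuous_on_const)
  moreover have "closed {f::'a \<Rightarrow> real. f x = 0}" for x
    by (intro closed_Collect_eq c continuous_on_const)
  moreover have "closed {f::'a \<Rightarrow> real. sum f \<sigma> = 1}"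
    by (intro closed_Collect_eq continuous_on_sum c continuous_on_const)
  ultimately show ?thesis
    by (simp add: closed_Int closed_INT)
qed

lemma simplex_points_mono:
  assumes "finite \<tau>" "\<sigma> \<subseteq> \<tau>"
  shows "simplex_points \<sigma> \<subseteq> simplex_points \<tau>"
proof
  fix f assume f: "f \<in> simplex_points \<sigma>"
  then have "sum f \<tau> = sum f \<sigma>"
    using assms by (intro sum.mono_neutral_right) (auto simp: simplex_points_def)
  then show "f \<in> simplex_points \<tau>"
    using f assms by (auto simp: simplex_points_def)
qed

lemma simplex_points_supp:
  assumes "finite \<sigma>" "x \<in> simplex_points \<sigma>"
  shows "supp x \<subseteq> \<sigma>" "supp x \<noteq> {}" "x \<in> simplex_points (supp x)"
proof -
  show 1: "supp x \<subseteq> \<sigma>"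
    using assms by (auto simp: simplex_points_def supp_def)
  have "sum x (supp x) = sum x \<sigma>"
    using assms 1 by (intro sum.mono_neutral_left) (auto simp: supp_def)
  then have 2: "sum x (supp x) = 1"
    using assms by (simp add: simplex_points_def)
  then show "supp x \<noteq> {}" by auto
  show "x \<in> simplex_points (supp x)"
    using assms 2 by (auto simp: simplex_points_def supp_def)
qed

lemma simplex_points_convex:
  assumes "f \<in> simplex_points \<sigma>" "g \<in> simplex_points \<sigma>" "t \<in> {0..1}"
  shows "(\<lambda>v. (1 - t) * f v + t * g v) \<in> simplex_points \<sigma>"
  using assms by (auto simp: simplex_points_def sum.distrib simp flip: sum_distrib_left)

section \<open>Weak topology: continuity out of, and into, a realization\<close>

lemma openin_realization_topology:
  "openin (realization_topology K) U \<longleftrightarrow> U \<subseteq> realization K \<and>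
      (\<forall>\<sigma>\<in>K. openin (top_of_set (simplex_points \<sigma>)) (U \<inter> simplex_points \<sigma>))"
proof -
  have "istopology (\<lambda>U. U \<subseteq> realization K \<and>
      (\<forall>\<sigma>\<in>K. openin (top_of_set (simplex_points \<sigma>)) (U \<inter> simplex_points \<sigma>)))"
  proof (unfold istopology_def, intro conjI allI impI ballI)
    fix S T \<sigma>
    assume "S \<subseteq> realization K \<and> (\<forall>\<sigma>\<in>K. openin (top_of_set (simplex_points \<sigma>)) (S \<inter> simplex_points \<sigma>))"
      "T \<subseteq> realization K \<and> (\<forall>\<sigma>\<in>K. openin (top_of_set (simplex_points \<sigma>)) (T \<inter> simplex_points \<sigma>))"
      "\<sigma> \<in> K"
    then have "openin (top_of_set (simplex_points \<sigma>)) ((S \<inter> simplex_points \<sigma>) \<inter> (T \<inter> simplex_points \<sigma>))"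
      by blast
    then show "openin (top_of_set (simplex_points \<sigma>)) (S \<inter> T \<inter> simplex_points \<sigma>)"
      by (simp add: Int_ac)
  next
    fix \<U> \<sigma>
    assume *: "\<forall>S\<in>\<U>. S \<subseteq> realization K \<and> (\<forall>\<sigma>\<in>K. openin (top_of_set (simplex_points \<sigma>)) (S \<inter> simplex_points \<sigma>))"
      "\<sigma> \<in> K"
    then have "openin (top_of_set (simplex_points \<sigma>)) (\<Union>S\<in>\<U>. S \<inter> simplex_points \<sigma>)"
      by blast
    then show "openin (top_of_set (simplex_points \<sigma>)) (\<Union>\<U> \<inter> simplex_points \<sigma>)"
      by (metis Int_Union2)
  qed blast+
  then show ?thesis
    by (simp add: realization_topology_def topology_inverse')
qed

lemma topspace_realization_topology [simp]: "topspace (realization_topology K) = realization K"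
proof -
  have "realization K \<inter> simplex_points \<sigma> = simplex_points \<sigma>" if "\<sigma> \<in> K" for \<sigma>
    using that by (auto simp: realization_def)
  then have "openin (realization_topology K) (realization K)"
    by (simp add: openin_realization_topology)
  then show ?thesis
    using openin_realization_topology openin_subset openin_topspace by (metis subset_antisym)
qed

text \<open>Universal property of the weak topology: preimages are tested for openness one simplex
  at a time.\<close>

lemma continuous_map_from_realization:
  assumes "\<And>\<sigma>. \<sigma> \<in> K \<Longrightarrow> continuous_map (top_of_set (simplex_points \<sigma>)) Y f"
  shows "continuous_map (realization_topology K) Y f"
  unfolding continuous_map_def
proof (intro conjI allI impI)
  show "f \<in> topspace (realization_topology K) \<rightarrow> topspace Y"
    using assms by (fastforce simp: realization_def continuous_map_def)
next
  fix W assume W: "openin Y W"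
  have "{x \<in> realization K. f x \<in> W} \<inter> simplex_points \<sigma> = {x \<in> simplex_points \<sigma>. f x \<in> W}"
    if "\<sigma> \<in> K" for \<sigma>
    using that by (auto simp: realization_def)
  moreover have "openin (top_of_set (simplex_points \<sigma>)) {x \<in> simplex_points \<sigma>. f x \<in> W}"
    if "\<sigma> \<in> K" for \<sigma>
    using openin_continuous_map_preimage[OF assms[OF that] W] by simp
  ultimately show "openin (realization_topology K) {x \<in> topspace (realization_topology K). f x \<in> W}"
    by (auto simp: openin_realization_topology)
qed

text \<open>Coordinates are continuous on each simplex, so the weak topology is at least as fine as
  pointwise convergence. This brings maps into a realization back to
  \<open>continuous_on\<close>.\<close>

lemma continuous_map_realization_euclidean: "continuous_map (realization_topology K) euclidean id"
  by (rule continuous_map_from_realization) simp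

text \<open>Compactness of the interval enters through the tube lemma.\<close>
lemma continuous_map_from_prod_realization:
  assumes h: "\<And>\<sigma>. \<sigma> \<in> K \<Longrightarrow> continuous_map (top_of_set ({0..1::real} \<times> simplex_points \<sigma>)) Y h"
  shows "continuous_map (prod_topology (top_of_set {0..1}) (realization_topology K)) Y h"
  unfolding continuous_map_def
proof (intro conjI allI impI)
  show "h \<in> topspace (prod_topology (top_of_set {0..1}) (realization_topology K)) \<rightarrow> topspace Y"
    using h by (fastforce simp: realization_def continuous_map_def)
next
  fix W assume W: "openin Y W"
  define S where "S = {p \<in> {0..1} \<times> realization K. h p \<in> W}"
  have openS: "openin (top_of_set ({0..1} \<times> simplex_points \<sigma>)) (S \<inter> ({0..1} \<times> simplex_points \<sigma>))"
    if "\<sigma> \<in> K" for \<sigma>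
  proof -
    have "S \<inter> ({0..1} \<times> simplex_points \<sigma>) = {p \<in> {0..1} \<times> simplex_points \<sigma>. h p \<in> W}"
      using that by (auto simp: S_def realization_def)
    then show ?thesis
      using openin_continuous_map_preimage[OF h[OF that] W] by simp
  qed
  have "\<exists>U V. openin (top_of_set {0..1}) U \<and> openin (realization_topology K) V \<and> t \<in> U \<and> x \<in> V \<and> U \<times> V \<subseteq> S"
    if tx: "(t, x) \<in> S" for t x
  proof -
    obtain \<sigma> where \<sigma>: "\<sigma> \<in> K" "x \<in> simplex_points \<sigma>" and t: "t \<in> {0..1}"
      using tx by (auto simp: S_def realization_def)
    have "continuous_map (top_of_set {0..1}) (top_of_set ({0..1} \<times> simplex_points \<sigma>)) (\<lambda>s::real. (s, x))"
      using \<sigma> by (auto intro!: continuous_intros)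
    from openin_continuous_map_preimage[OF this openS[OF \<sigma>(1)]]
    have "openin (top_of_set {0..1}) {s \<in> {0..1}. (s, x) \<in> S}"
      using \<sigma> by (simp add: conj_ac cong: conj_cong)
    then obtain e where e: "e > 0" "cball t e \<inter> {0..1} \<subseteq> {s \<in> {0..1}. (s, x) \<in> S}"
      using tx t unfolding openin_contains_cball by blast
    define N where "N = cball t e \<inter> {0..1}"
    \<comment> \<open>One compact \<open>N\<close> is fixed for all simplices, so that
      \<open>V\<close> is defined on the whole realization and its openness can be tested simplex by
      simplex, each time by the tube lemma.\<close>
    define V where "V = {y \<in> realization K. \<forall>s\<in>N. (s, y) \<in> S}"
    have "openin (top_of_set (simplex_points \<tau>)) (V \<inter> simplex_points \<tau>)" if \<tau>: "\<tau> \<in> K" for \<tau>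
    proof (subst openin_subopen, intro ballI)
      fix y assume y: "y \<in> V \<inter> simplex_points \<tau>"
      have "\<exists>A B. openin (top_of_set {0..1}) A \<and> openin (top_of_set (simplex_points \<tau>)) B \<and> N \<subseteq> A \<and> y \<in> B
          \<and> A \<times> B \<subseteq> S \<inter> ({0..1} \<times> simplex_points \<tau>)"
      proof (rule tube_lemma_left)
        show "openin (prod_topology (top_of_set {0..1}) (top_of_set (simplex_points \<tau>)))
          (S \<inter> ({0..1} \<times> simplex_points \<tau>))"
          using openS[OF \<tau>] by simp
        show "compactin (top_of_set {0..1}) N"
          by (auto simp: compactin_subtopology N_def intro!: compact_Int)
        show "y \<in> topspace (top_of_set (simplex_points \<tau>))"
          using y by simp
        show "N \<times> {y} \<subseteq> S \<inter> ({0..1} \<times> simplex_points \<tau>)"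
          using y by (auto simp: V_def N_def)
      qed
      then obtain A B where AB: "openin (top_of_set (simplex_points \<tau>)) B" "N \<subseteq> A" "y \<in> B"
          "A \<times> B \<subseteq> S \<inter> ({0..1} \<times> simplex_points \<tau>)"
        by blast
      have "B \<subseteq> simplex_points \<tau>"
        using AB(1) openin_imp_subset by blast
      moreover have "simplex_points \<tau> \<subseteq> realization K"
        using \<tau> by (auto simp: realization_def)
      ultimately have "B \<subseteq> V \<inter> simplex_points \<tau>"
        using AB by (auto simp: V_def)
      then show "\<exists>T. openin (top_of_set (simplex_points \<tau>)) T \<and> y \<in> T \<and> T \<subseteq> V \<inter> simplex_points \<tau>"
        using AB by blast
    qed
    then have "openin (realization_topology K) V"
      by (auto simp: openin_realization_topology V_def)
    moreover have "openin (top_of_set {0..1}) (ball t e \<inter> {0..1})"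
      by (metis inf_commute open_ball openin_open_Int)
    moreover have "x \<in> V"
      using e tx by (auto simp: V_def N_def S_def)
    moreover have "(ball t e \<inter> {0..1}) \<times> V \<subseteq> S"
      by (auto simp: V_def N_def)
    ultimately show ?thesis
      using e t by (meson IntI centre_in_ball)
  qed
  then have "openin (prod_topology (top_of_set {0..1}) (realization_topology K)) S"
    by (simp add: openin_prod_topology_alt)
  then show "openin (prod_topology (top_of_set {0..1}) (realization_topology K))
         {x \<in> topspace (prod_topology (top_of_set {0..1}) (realization_topology K)). h x \<in> W}"
    by (simp add: S_def)
qed

text \<open>Over a finite vertex set there are finitely many simplices, each closed in the
  coordinate topology. The part of the subcomplex outside a weakly open \<open>U\<close> is then a
  finite union \<open>C\<close> of closed sets, so coordinatewise continuity of \<open>f\<close>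
  suffices.\<close>

lemma continuous_map_into_realization:
  assumes "finite F" and f: "continuous_map X euclidean f"
    and im: "f ` topspace X \<subseteq> realization (induced K F)"
  shows "continuous_map X (realization_topology K) f"
  unfolding continuous_map_def
proof (intro conjI allI impI)
  show "f \<in> topspace X \<rightarrow> topspace (realization_topology K)"
    using im realization_mono[of "induced K F" K] by (auto simp: induced_def)
next
  fix U assume U: "openin (realization_topology K) U"
  define C where "C = (\<Union>\<tau>\<in>induced K F. simplex_points \<tau> - U)"
  have "closed (simplex_points \<tau> - U)" if "\<tau> \<in> K" for \<tau>
  proof -
    have "openin (top_of_set (simplex_points \<tau>)) (U \<inter> simplex_points \<tau>)"
      using U that by (simp add: openin_realization_topology)
    then obtain T where "open T" "U \<inter> simplex_points \<tau> = simplex_points \<tau> \<inter> T"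
      by (auto simp: openin_open)
    then have "simplex_points \<tau> - U = simplex_points \<tau> \<inter> - T" "closed (- T)"
      by auto
    then show ?thesis
      using closed_simplex_points by (metis closed_Int)
  qed
  then have "closed C"
    unfolding C_def using finite_induced[OF assms(1)] by (intro closed_UN) (auto simp: induced_def)
  then have "openin X {x \<in> topspace X. f x \<in> - C}"
    using openin_continuous_map_preimage[OF f] by (metis open_Compl open_openin)
  moreover have "{x \<in> topspace X. f x \<in> - C} = {x \<in> topspace X. f x \<in> U}"
  proof -
    have "f x \<in> - C \<longleftrightarrow> f x \<in> U" if "x \<in> topspace X" for x
    proof -
      have "f x \<in> realization (induced K F)"
        using im that by blast
      then show ?thesis
        by (auto simp: C_def realization_def)
    qed
    then show ?thesis by blast
  qed
  ultimately show "openin X {x \<in> topspace X. f x \<in> U}"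
    by simp
qed

text \<open>Contiguity for maps that need not be simplicial: a common target simplex is convex, so
  the segments between the two images stay in it.\<close>

lemma homotopic_straight_line:
  fixes f g :: "('a \<Rightarrow> real) \<Rightarrow> 'b \<Rightarrow> real"
  assumes fin: "\<And>\<rho>. \<rho> \<in> L \<Longrightarrow> finite \<rho>"
    and fg: "\<And>\<sigma>. \<sigma> \<in> K \<Longrightarrow> continuous_on (simplex_points \<sigma>) f \<and> continuous_on (simplex_points \<sigma>) g \<and>
      (\<exists>\<rho>\<in>L. f ` simplex_points \<sigma> \<subseteq> simplex_points \<rho> \<and> g ` simplex_points \<sigma> \<subseteq> simplex_points \<rho>)"
  shows "homotopic_with (\<lambda>_. True) (realization_topology K) (realization_topology L) f g"
proof -
  define h where "h = (\<lambda>(t::real, x). (\<lambda>v. (1 - t) * f x v + t * g x v))"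
  have "continuous_map (top_of_set ({0..1} \<times> simplex_points \<sigma>)) (realization_topology L) h"
    if \<sigma>: "\<sigma> \<in> K" for \<sigma>
  proof -
    obtain \<rho> where \<rho>: "\<rho> \<in> L" "f ` simplex_points \<sigma> \<subseteq> simplex_points \<rho>" "g ` simplex_points \<sigma> \<subseteq> simplex_points \<rho>"
      using fg[OF \<sigma>] by blast
    have comp: "continuous_on ({0..1} \<times> simplex_points \<sigma>) (\<lambda>p::real \<times> _. k (snd p))"
      if "continuous_on (simplex_points \<sigma>) k" for k :: "('a \<Rightarrow> real) \<Rightarrow> real"
    proof (rule continuous_on_compose2[OF that])
      show "continuous_on ({0..1} \<times> simplex_points \<sigma>) (\<lambda>p::real \<times> _. snd p)"
        by (intro continuous_intros)
    qed auto
    have "continuous_on ({0..1} \<times> simplex_points \<sigma>) h"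
      unfolding h_def case_prod_beta
      by (intro continuous_on_coordinatewise_then_product continuous_on_add continuous_on_mult comp
          continuous_on_diff continuous_on_const continuous_on_fst continuous_on_id) (use fg[OF \<sigma>] in \<open>auto intro: continuous_on_product_then_coordinatewise\<close>)
    moreover have "h ` ({0..1} \<times> simplex_points \<sigma>) \<subseteq> simplex_points \<rho>"
    proof clarsimp
      fix t :: real and x assume "0 \<le> t" "t \<le> 1" "x \<in> simplex_points \<sigma>"
      then show "h (t, x) \<in> simplex_points \<rho>"
        using \<rho> unfolding h_def by (auto intro!: simplex_points_convex)
    qed
    moreover have "simplex_points \<rho> \<subseteq> realization (induced L \<rho>)"
      using \<rho> by (auto simp: realization_def induced_def)
    ultimately show ?thesis
      using fin[OF \<rho>(1)] by (intro continuous_map_into_realization[where F = \<rho>]) auto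
  qed
  then have "continuous_map (prod_topology (top_of_set {0..1}) (realization_topology K)) (realization_topology L) h"
    by (rule continuous_map_from_prod_realization)
  moreover have "h (0, x) = f x" "h (1, x) = g x" for x
    by (simp_all add: h_def)
  ultimately show ?thesis
    unfolding homotopic_with_def by blast
qed

section \<open>Simplicial maps and contiguous deformations\<close>

text \<open>The affine extension of the vertex map \<open>p\<close>, written as the pushforward of
  barycentric weights. Summing over a fixed finite \<open>F\<close> instead of over the carrier of
  \<open>x\<close> gives one formula that is visibly continuous.\<close>

definition push :: "'a set \<Rightarrow> ('a \<Rightarrow> 'b) \<Rightarrow> ('a \<Rightarrow> real) \<Rightarrow> 'b \<Rightarrow> real" where
  "push F p x = (\<lambda>v. sum x {a\<in>F. p a = v})"

lemma continuous_on_push: "continuous_on S (push F p)"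
  unfolding push_def
  by (intro continuous_on_coordinatewise_then_product continuous_on_sum)
     (rule continuous_on_subset[OF continuous_on_product_coordinates], simp)

lemma push_simplex_points:
  assumes "finite F" "\<tau> \<subseteq> F" "finite \<rho>" "p ` \<tau> \<subseteq> \<rho>" and x: "x \<in> simplex_points \<tau>"
  shows "push F p x \<in> simplex_points \<rho>"
proof -
  have fin: "finite \<tau>"
    using assms finite_subset by blast
  have eq: "push F p x v = sum x {a\<in>\<tau>. p a = v}" for v
    unfolding push_def using assms by (intro sum.mono_neutral_right) (auto simp: simplex_points_def)
  have "sum (push F p x) \<rho> = sum x \<tau>"
    unfolding eq using assms fin by (intro sum.group) auto
  moreover have "push F p x v = 0" if "v \<notin> \<rho>" for v
  proof -
    have "{a\<in>\<tau>. p a = v} = {}"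
      using assms that by blast
    then show ?thesis by (metis eq sum.empty)
  qed
  ultimately show ?thesis
    using x by (auto simp: simplex_points_def push_def sum_nonneg)
qed

lemma push_id:
  assumes "finite F" "\<tau> \<subseteq> F" "\<And>a. a \<in> F \<Longrightarrow> p a = a" "x \<in> simplex_points \<tau>"
  shows "push F p x = x"
proof
  fix v
  have "{a\<in>F. p a = v} = (if v \<in> F then {v} else {})"
    using assms by auto
  then show "push F p x v = x v"
    using assms by (auto simp: push_def simplex_points_def)
qed

text \<open>A finite induced subcomplex is contracted in steps so small that consecutive vertex maps
  are contiguous.\<close>
lemma nullhomotopic_induced:
  fixes p :: "real \<Rightarrow> 'a \<Rightarrow> 'a"
  assumes "finite F" and fin: "\<And>\<tau>. \<tau> \<in> K \<Longrightarrow> finite \<tau>"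
    and p1: "\<And>a. a \<in> F \<Longrightarrow> p 1 a = a" and p0: "\<And>a. a \<in> F \<Longrightarrow> p 0 a = z"
    and pA: "\<And>t a. t \<in> {0..1} \<Longrightarrow> a \<in> F \<Longrightarrow> p t a \<in> A"
    and slack: "\<And>\<tau>. \<tau> \<in> K \<Longrightarrow> \<tau> \<subseteq> F \<Longrightarrow>
      \<exists>\<delta>>0. \<forall>s\<in>{0..1}. \<forall>t\<in>{0..1}. \<bar>s - t\<bar> < \<delta> \<longrightarrow> p s ` \<tau> \<union> p t ` \<tau> \<in> K"
  shows "\<exists>F' c. finite F' \<and> F' \<subseteq> A \<and>
    homotopic_with (\<lambda>_. True) (realization_topology (induced K F)) (realization_topology (induced K F')) id (\<lambda>_. c)"
proof -
  obtain \<delta> where \<delta>: "\<And>\<tau>. \<tau> \<in> induced K F \<Longrightarrow> \<delta> \<tau> > 0 \<and>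
      (\<forall>s\<in>{0..1}. \<forall>t\<in>{0..1}. \<bar>s - t\<bar> < \<delta> \<tau> \<longrightarrow> p s ` \<tau> \<union> p t ` \<tau> \<in> K)"
    using slack unfolding induced_def by (simp add: Ball_def) metis
  \<comment> \<open>\<open>insert 1\<close> keeps the minimum meaningful when no simplex of
    \<open>K\<close> lies over \<open>F\<close>.\<close>
  define e where "e = Min (insert 1 (\<delta> ` induced K F))"
  have fI: "finite (induced K F)"
    by (simp add: finite_induced assms(1))
  have "e > 0"
    using \<delta> fI by (simp add: e_def)
  then obtain N :: nat where N: "N > 0" "1 / N < e"
    by (metis nat_approx_posE of_nat_Suc zero_less_Suc)
  have eN: "1 / N < \<delta> \<tau>" if "\<tau> \<in> induced K F" for \<tau>
  proof -
    have "e \<le> \<delta> \<tau>"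
      using that fI by (simp add: e_def)
    then show ?thesis using N by linarith
  qed
  \<comment> \<open>All positions of the vertices at the \<open>N + 1\<close> sampled times.
    Sampling keeps this set finite, which the full tracks of the vertices would not be.\<close>
  define F' where "F' = (\<Union>j\<le>N. p (j / N) ` F)"
  have fF': "finite F'"
    using assms(1) by (simp add: F'_def)
  have F'A: "F' \<subseteq> A"
    using pA N by (force simp: F'_def divide_simps)
  let ?R = "realization_topology (induced K F)" and ?R' = "realization_topology (induced K F')"
  define P where "P j = push F (p (real j / N))" for j :: nat
  have step: "homotopic_with (\<lambda>_. True) ?R ?R' (P i) (P j)"
    if ij: "i \<le> N" "j \<le> N" "\<bar>real i - real j\<bar> \<le> 1" for i j
  proof (rule homotopic_straight_line)
    show "finite \<rho>" if "\<rho> \<in> induced K F'" for \<rho>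
      using that fin by (simp add: induced_def)
    fix \<tau> assume \<tau>: "\<tau> \<in> induced K F"
    then have \<tau>F: "\<tau> \<subseteq> F" "finite \<tau>"
      using fin by (auto simp: induced_def)
    define \<rho> where "\<rho> = p (i / N) ` \<tau> \<union> p (j / N) ` \<tau>"
    have "\<bar>real i / N - real j / N\<bar> = \<bar>real i - real j\<bar> / N"
      by (simp flip: diff_divide_distrib)
    also have "\<dots> \<le> 1 / N"
      using ij by (intro divide_right_mono) auto
    finally have "\<bar>real i / N - real j / N\<bar> < \<delta> \<tau>"
      using eN[OF \<tau>] by linarith
    moreover have "real i / N \<in> {0..1}" "real j / N \<in> {0..1}"
      using ij N by (auto simp: divide_simps)
    ultimately have "\<rho> \<in> K"
      using \<delta>[OF \<tau>] unfolding \<rho>_def by blast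
    moreover have "\<rho> \<subseteq> F'"
      using ij \<tau>F unfolding \<rho>_def F'_def by blast
    ultimately have \<rho>: "\<rho> \<in> induced K F'"
      by (simp add: induced_def)
    have "P i ` simplex_points \<tau> \<subseteq> simplex_points \<rho>" "P j ` simplex_points \<tau> \<subseteq> simplex_points \<rho>"
      unfolding P_def using assms(1) \<tau>F
      by (auto intro!: push_simplex_points[where \<tau> = \<tau>] simp: \<rho>_def)
    then show "continuous_on (simplex_points \<tau>) (P i) \<and> continuous_on (simplex_points \<tau>) (P j) \<and>
        (\<exists>\<rho>\<in>induced K F'. P i ` simplex_points \<tau> \<subseteq> simplex_points \<rho> \<and> P j ` simplex_points \<tau> \<subseteq> simplex_points \<rho>)"
      using \<rho> continuous_on_push unfolding P_def by blast
  qed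
  \<comment> \<open>The steps are chained backwards, from time 1, where the vertices of
    \<open>F\<close> are fixed, to time 0, where they have all arrived at \<open>z\<close>.\<close>
  have hom: "homotopic_with (\<lambda>_. True) ?R ?R' (P N) (P (N - j))" if "j \<le> N" for j
    using that
  proof (induction j)
    case 0
    show ?case using step[of N N] by simp
  next
    case (Suc j)
    then have "homotopic_with (\<lambda>_. True) ?R ?R' (P (N - j)) (P (N - Suc j))"
      by (intro step) auto
    then show ?case
      using Suc homotopic_with_trans Suc_leD by blast
  qed
  have eq1: "P N x = id x" if x: "x \<in> topspace ?R" for x
  proof -
    obtain \<tau> where "\<tau> \<subseteq> F" "x \<in> simplex_points \<tau>"
      using x by (auto simp: realization_def induced_def)
    then show ?thesis
      using push_id[of F \<tau> "p 1" x] assms(1) p1 N by (simp add: P_def)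
  qed
  have eq0: "P 0 x = (\<lambda>v. if v = z then 1 else 0)" if x: "x \<in> topspace ?R" for x
  proof -
    obtain \<tau> where \<tau>: "\<tau> \<subseteq> F" "x \<in> simplex_points \<tau>"
      using x by (auto simp: realization_def induced_def)
    then have "P 0 x \<in> simplex_points {z}"
      unfolding P_def using assms(1) p0 by (intro push_simplex_points[where \<tau> = \<tau>]) auto
    then show ?thesis
      by (auto simp: simplex_points_def)
  qed
  have "homotopic_with (\<lambda>_. True) ?R ?R' id (\<lambda>_ v. if v = z then 1 else 0)"
    by (rule homotopic_with_eq[OF hom[of N]]) (use eq0 eq1 in auto)
  then show ?thesis
    using fF' F'A by blast
qed

section \<open>Extension over a single simplex\<close>

lemma continuous_on_Min_coordinates:
  fixes \<sigma> :: "'a set"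
  assumes "finite \<sigma>" "\<sigma> \<noteq> {}"
  shows "continuous_on S (\<lambda>x::'a \<Rightarrow> real. Min (x ` \<sigma>))"
  using assms
proof (induction \<sigma> rule: finite_ne_induct)
  case (singleton a)
  show ?case
    by simp (rule continuous_on_subset[OF continuous_on_product_coordinates], simp)
next
  case (insert a \<sigma>)
  have "continuous_on S (\<lambda>x::'a \<Rightarrow> real. min (x a) (Min (x ` \<sigma>)))"
    by (intro continuous_on_min insert) (rule continuous_on_subset[OF continuous_on_product_coordinates], simp)
  then show ?case
    using insert by simp
qed

text \<open>The simplex is the cone over its boundary with apex the barycenter: the half of the cone
  near the boundary carries the null-homotopy and the other half is constant.\<close>
lemma extend_over_simplex:
  fixes \<sigma> :: "'a set" and g :: "('a \<Rightarrow> real) \<Rightarrow> 'a \<Rightarrow> real"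
  defines "B \<equiv> {x \<in> simplex_points \<sigma>. \<exists>a\<in>\<sigma>. x a = 0}"
  assumes fin: "finite \<sigma>" and B: "B \<noteq> {}" and F: "finite F" and g: "continuous_on B g" "g ` B \<subseteq> realization (induced K F)"
    and hom: "homotopic_with (\<lambda>_. True) (realization_topology (induced K F)) (realization_topology (induced K F')) id (\<lambda>_. c)"
  shows "\<exists>e. continuous_on (simplex_points \<sigma>) e \<and> (\<forall>x\<in>B. e x = g x) \<and>
    e ` simplex_points \<sigma> \<subseteq> realization (induced K F')"
proof -
  define n where "n = real (card \<sigma>)"
  \<comment> \<open>The cone parameter is \<open>n * m x\<close>: it is 0 on the boundary and 1 at
    the barycenter, where all coordinates equal 1/n.\<close>
  define m where "m x = Min (x ` \<sigma>)" for x :: "'a \<Rightarrow> real"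
  define S where "S = {x \<in> simplex_points \<sigma>. 2 * n * m x \<le> 1}"
  \<comment> \<open>Radial projection from the barycenter to the boundary: \<open>x\<close> is the
    barycenter weighted by \<open>n * m x\<close> plus \<open>y x\<close> weighted by the rest. On
    \<open>S\<close> the denominator is at least 1/2, so the apex causes no trouble.\<close>
  define y where "y x = (\<lambda>v. (x v - (if v \<in> \<sigma> then m x else 0)) / (1 - n * m x))" for x
  have ne: "\<sigma> \<noteq> {}"
    using B unfolding B_def by blast
  have ml: "m x \<le> x v" if "v \<in> \<sigma>" for x v
    using that fin by (simp add: m_def)
  have m0: "m x \<ge> 0" if "x \<in> simplex_points \<sigma>" for x
    using that fin ne by (auto simp: m_def simplex_points_def)
  have cm: "continuous_on T m" for T
    unfolding m_def by (rule continuous_on_Min_coordinates[OF fin ne])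
  have cx: "continuous_on T (\<lambda>x::'a \<Rightarrow> real. x v)" for T v
    by (rule continuous_on_subset[OF continuous_on_product_coordinates]) simp
  have ci: "continuous_on T (\<lambda>x. if v \<in> \<sigma> then m x else 0)" for T v
    by (cases "v \<in> \<sigma>") (simp_all add: cm)
  have cy: "continuous_on S y"
    unfolding y_def S_def
    by (intro continuous_on_coordinatewise_then_product continuous_intros cx ci cm) auto
  have yB: "y x \<in> B" if x: "x \<in> S" for x
  proof -
    have d: "1 - n * m x > 0"
      using x by (simp add: S_def)
    have xs: "x \<in> simplex_points \<sigma>"
      using x by (simp add: S_def)
    have "sum (y x) \<sigma> = (\<Sum>v\<in>\<sigma>. x v - m x) / (1 - n * m x)"
      unfolding y_def sum_divide_distrib by (intro sum.cong) auto
    also have "\<dots> = 1"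
      using d xs by (simp add: sum_subtractf n_def simplex_points_def)
    finally have "sum (y x) \<sigma> = 1" .
    moreover have "y x v \<ge> 0" for v
      using d ml[of v x] xs by (auto simp: y_def simplex_points_def)
    moreover have "y x v = 0" if "v \<notin> \<sigma>" for v
      using that xs by (auto simp: y_def simplex_points_def)
    moreover have "\<exists>a\<in>\<sigma>. y x a = 0"
    proof -
      have "m x \<in> x ` \<sigma>"
        unfolding m_def using fin ne by (intro Min_in) auto
      then show ?thesis by (auto simp: y_def)
    qed
    ultimately show ?thesis
      by (auto simp: B_def simplex_points_def)
  qed
  have mB: "m x = 0" if "x \<in> B" for x
    using that ml m0 unfolding B_def by (smt (verit) mem_Collect_eq)
  let ?R = "realization_topology (induced K F)" and ?R' = "realization_topology (induced K F')"
  obtain h where h: "continuous_map (prod_topology (top_of_set {0..1::real}) ?R) ?R' h"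
    and h0: "\<And>x. h (0, x) = x" and h1: "\<And>x. h (1, x) = c"
    using hom unfolding homotopic_with_def by auto
  have him: "h (t, x) \<in> realization (induced K F')" if "t \<in> {0..1}" "x \<in> realization (induced K F)" for t x
    using that continuous_map_funspace[OF h] by (auto simp: Pi_iff)
  have FF: "induced (induced K F) F = induced K F"
    by (auto simp: induced_def)
  \<comment> \<open>Nonemptiness of \<open>B\<close> enters here: a homotopy with empty domain would
    not locate its constant \<open>c\<close>.\<close>
  have c: "c \<in> realization (induced K F')"
  proof -
    obtain b where "b \<in> B" using B by blast
    then have "h (1, g b) \<in> realization (induced K F')"
      using g by (intro him) auto
    then show ?thesis by (simp add: h1)
  qed
  define e where "e x = (if 2 * n * m x \<le> 1 then h (2 * n * m x, g (y x)) else c)" for x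
  have "continuous_map (top_of_set S) ?R (\<lambda>x. g (y x))"
  proof (rule continuous_map_into_realization[OF F])
    have "continuous_on S (\<lambda>x. g (y x))"
      using yB by (intro continuous_on_compose2[OF g(1) cy]) auto
    then show "continuous_map (top_of_set S) euclidean (\<lambda>x. g (y x))"
      by simp
    show "(\<lambda>x. g (y x)) ` topspace (top_of_set S) \<subseteq> realization (induced (induced K F) F)"
      unfolding FF using yB g by auto
  qed
  moreover have "continuous_map (top_of_set S) (top_of_set {0..1}) (\<lambda>x. 2 * n * m x)"
    using m0 by (auto intro!: continuous_intros cm simp: S_def n_def)
  ultimately have "continuous_map (top_of_set S) (prod_topology (top_of_set {0..1}) ?R) (\<lambda>x. (2 * n * m x, g (y x)))"
    by (simp add: continuous_map_paired)
  from continuous_map_compose[OF continuous_map_compose[OF this h] continuous_map_realization_euclidean]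
  have cS: "continuous_on S (\<lambda>x. h (2 * n * m x, g (y x)))"
    by (simp add: o_def)
  have "continuous_on (simplex_points \<sigma>) e"
    unfolding e_def
  proof (rule continuous_on_cases_le)
    show "continuous_on {x \<in> simplex_points \<sigma>. 2 * n * m x \<le> 1} (\<lambda>x. h (2 * n * m x, g (y x)))"
      using cS by (simp add: S_def)
    show "continuous_on (simplex_points \<sigma>) (\<lambda>x. 2 * n * m x)"
      by (intro continuous_intros cm)
  qed (auto simp: h1)
  moreover have "e x = g x" if "x \<in> B" for x
  proof -
    have "y x = x"
      using that by (auto simp: y_def mB)
    then show ?thesis
      using that by (simp add: e_def mB h0)
  qed
  moreover have "e x \<in> realization (induced K F')" if x: "x \<in> simplex_points \<sigma>" for x
  proof (cases "2 * n * m x \<le> 1")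
    case True
    then have "g (y x) \<in> realization (induced K F)"
      using yB[of x] x g by (auto simp: S_def)
    then show ?thesis
      using True m0[OF x] by (auto simp: e_def n_def intro!: him)
  qed (simp add: e_def c)
  ultimately show ?thesis by blast
qed

section \<open>Deforming a complex onto a subcomplex with the same vertices\<close>

text \<open>A retraction \<open>g\<close> of \<open>L\<close> onto \<open>K\<close> with \<open>g \<sigma>\<close> inside \<open>K\<close> restricted to \<open>A \<sigma>\<close> is built
  by induction over skeleta; as \<open>A \<sigma>\<close> spans a full simplex in \<open>L\<close>, it is linearly homotopic to the identity.\<close>
lemma homotopy_equivalence_inclusion:
  fixes K L :: "'a set set" and A :: "'a set \<Rightarrow> 'a set"
  assumes KL: "K \<subseteq> L"
    and fin: "\<And>\<sigma>. \<sigma> \<in> L \<Longrightarrow> finite \<sigma>"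
    and downL: "\<And>\<sigma> \<tau>. \<sigma> \<in> L \<Longrightarrow> \<tau> \<subseteq> \<sigma> \<Longrightarrow> \<tau> \<noteq> {} \<Longrightarrow> \<tau> \<in> L"
    and downK: "\<And>\<sigma> \<tau>. \<sigma> \<in> K \<Longrightarrow> \<tau> \<subseteq> \<sigma> \<Longrightarrow> \<tau> \<noteq> {} \<Longrightarrow> \<tau> \<in> K"
    and vert: "\<And>v. {v} \<in> L \<Longrightarrow> {v} \<in> K"
    and mono: "\<And>\<sigma> \<tau>. \<sigma> \<in> L \<Longrightarrow> \<tau> \<subseteq> \<sigma> \<Longrightarrow> \<tau> \<noteq> {} \<Longrightarrow> A \<tau> \<subseteq> A \<sigma>"
    and sub: "\<And>\<sigma>. \<sigma> \<in> L \<Longrightarrow> \<sigma> \<subseteq> A \<sigma>"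
    and full: "\<And>\<sigma> \<tau>. \<sigma> \<in> L \<Longrightarrow> finite \<tau> \<Longrightarrow> \<tau> \<noteq> {} \<Longrightarrow> \<tau> \<subseteq> A \<sigma> \<Longrightarrow> \<tau> \<in> L"
    and null: "\<And>\<sigma> F. \<sigma> \<in> L \<Longrightarrow> finite F \<Longrightarrow> F \<subseteq> A \<sigma> \<Longrightarrow> \<exists>F' c. finite F' \<and> F' \<subseteq> A \<sigma> \<and>
      homotopic_with (\<lambda>_. True) (realization_topology (induced K F)) (realization_topology (induced K F')) id (\<lambda>_. c)"
  shows "homotopy_equivalence_map (realization_topology K) (realization_topology L) id"
proof -
  define good where "good g \<sigma> \<longleftrightarrow> continuous_on (simplex_points \<sigma>) g \<and>
    (\<exists>F. finite F \<and> F \<subseteq> A \<sigma> \<and> g ` simplex_points \<sigma> \<subseteq> realization (induced K F))"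
    for g :: "('a \<Rightarrow> real) \<Rightarrow> 'a \<Rightarrow> real" and \<sigma>
  \<comment> \<open>\<open>card \<sigma> \<le> Suc n\<close> means dimension at most
    \<open>n\<close>. The map is already the identity on all of \<open>realization K\<close>, not
    just on a skeleton of it, so later stages never have to reconcile the two conditions.\<close>
  define P where "P n g \<longleftrightarrow> (\<forall>x\<in>realization K. g x = x) \<and> (\<forall>\<sigma>\<in>L. card \<sigma> \<le> Suc n \<longrightarrow> good g \<sigma>)"
    for n and g :: "('a \<Rightarrow> real) \<Rightarrow> 'a \<Rightarrow> real"
  define Q where "Q n g g' \<longleftrightarrow> (\<forall>\<sigma>\<in>L. card \<sigma> \<le> Suc n \<longrightarrow> (\<forall>x\<in>simplex_points \<sigma>. g' x = g x))"
    for n and g g' :: "('a \<Rightarrow> real) \<Rightarrow> 'a \<Rightarrow> real"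
  have supp: "supp x \<subseteq> \<sigma>" "supp x \<noteq> {}" "x \<in> simplex_points (supp x)" if "\<sigma> \<in> L" "x \<in> simplex_points \<sigma>" for x \<sigma>
    using simplex_points_supp[OF fin[OF that(1)] that(2)] by auto
  have suppL: "supp x \<in> L" if "\<sigma> \<in> L" "x \<in> simplex_points \<sigma>" for x \<sigma>
    using supp[OF that] downL that by blast
  have suppK: "supp x \<in> K" if "\<sigma> \<in> K" "x \<in> simplex_points \<sigma>" for x \<sigma>
    using supp[of \<sigma> x] downK that KL by blast
  have goodK: "good g \<sigma>" if g: "\<forall>x\<in>realization K. g x = x" and \<sigma>: "\<sigma> \<in> K" for g \<sigma>
  proof -
    have eq: "g x = x" if "x \<in> simplex_points \<sigma>" for x
      using g realizationI[OF \<sigma> that] by blast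
    have "continuous_on (simplex_points \<sigma>) g"
      using continuous_on_cong[OF refl eq] by (simp add: eq)
    moreover have "g ` simplex_points \<sigma> \<subseteq> realization (induced K \<sigma>)"
      using eq \<sigma> by (auto intro!: realizationI[of \<sigma>] simp: induced_def)
    moreover have "finite \<sigma>" "\<sigma> \<subseteq> A \<sigma>"
      using \<sigma> KL sub fin by auto
    ultimately show ?thesis
      by (auto simp: good_def)
  qed
  have goodcong: "good g' \<sigma>" if "good g \<sigma>" and eq: "\<And>x. x \<in> simplex_points \<sigma> \<Longrightarrow> g' x = g x" for g g' \<sigma>
  proof -
    have "continuous_on (simplex_points \<sigma>) g' = continuous_on (simplex_points \<sigma>) g"
      by (rule continuous_on_cong[OF refl eq])
    moreover have "g' ` simplex_points \<sigma> = g ` simplex_points \<sigma>"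
      using eq by (rule image_cong[OF refl])
    ultimately show ?thesis
      using that(1) by (simp add: good_def)
  qed
  have step: "\<exists>g'. P (Suc n) g' \<and> Q n g g'" if g: "P n g" for n g
  proof -
    have gK: "g x = x" if "x \<in> realization K" for x
      using g that by (auto simp: P_def)
    define B where "B \<sigma> = {x \<in> simplex_points \<sigma>. \<exists>a\<in>\<sigma>. x a = 0}" for \<sigma> :: "'a set"
    have "\<exists>e. continuous_on (simplex_points \<sigma>) e \<and> (\<forall>x\<in>B \<sigma>. e x = g x) \<and>
        (\<exists>F. finite F \<and> F \<subseteq> A \<sigma> \<and> e ` simplex_points \<sigma> \<subseteq> realization (induced K F))"
      if \<sigma>: "\<sigma> \<in> L" "card \<sigma> = Suc (Suc n)" for \<sigma>
    proof -
      have f: "finite \<sigma>" using \<sigma> fin by blast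
      define T where "T = (\<lambda>a. \<sigma> - {a}) ` \<sigma>"
      have T: "\<tau> \<in> L" "\<tau> \<subseteq> \<sigma>" "\<tau> \<noteq> {}" "good g \<tau>" if "\<tau> \<in> T" for \<tau>
      proof -
        obtain a where a: "a \<in> \<sigma>" "\<tau> = \<sigma> - {a}"
          using \<open>\<tau> \<in> T\<close> by (auto simp: T_def)
        have c: "card \<tau> = Suc n"
          using a f \<sigma> by simp
        then show "\<tau> \<noteq> {}"
          by auto
        show "\<tau> \<subseteq> \<sigma>"
          using a by auto
        show "\<tau> \<in> L"
          using downL[OF \<sigma>(1) \<open>\<tau> \<subseteq> \<sigma>\<close> \<open>\<tau> \<noteq> {}\<close>] .
        then show "good g \<tau>"
          using g c by (auto simp: P_def)
      qed
      have BT: "B \<sigma> = (\<Union>\<tau>\<in>T. simplex_points \<tau>)"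
      proof -
        have "x \<in> simplex_points (\<sigma> - {a}) \<longleftrightarrow> x \<in> simplex_points \<sigma> \<and> x a = 0" if "a \<in> \<sigma>" for x a
          using f that by (auto simp: simplex_points_def sum.remove)
        then show ?thesis by (auto simp: B_def T_def)
      qed
      have "continuous_on (B \<sigma>) g"
        unfolding BT using T f
        by (intro continuous_on_closed_Union) (auto simp: T_def good_def closed_simplex_points)
      moreover
      obtain \<Phi> where \<Phi>: "\<And>\<tau>. \<tau> \<in> T \<Longrightarrow> finite (\<Phi> \<tau>) \<and> \<Phi> \<tau> \<subseteq> A \<tau> \<and>
          g ` simplex_points \<tau> \<subseteq> realization (induced K (\<Phi> \<tau>))"
        using T(4) unfolding good_def by metis
      define F where "F = \<Union>(\<Phi> ` T)"
      have fF: "finite F"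
        using \<Phi> f by (auto simp: F_def T_def)
      have FA: "F \<subseteq> A \<sigma>"
      proof -
        have "\<Phi> \<tau> \<subseteq> A \<sigma>" if "\<tau> \<in> T" for \<tau>
          using \<Phi>[OF that] mono[OF \<sigma>(1) T(2,3)[OF that]] by (meson order_trans)
        then show ?thesis by (simp add: F_def UN_least)
      qed
      have gB: "g ` B \<sigma> \<subseteq> realization (induced K F)"
      proof -
        have "realization (induced K (\<Phi> \<tau>)) \<subseteq> realization (induced K F)" if "\<tau> \<in> T" for \<tau>
          using that by (intro realization_mono) (auto simp: induced_def F_def)
        then show ?thesis
          unfolding BT image_UN using \<Phi> by (meson UN_least order_trans)
      qed
      \<comment> \<open>A simplex with at least two vertices has a vertex in its boundary, as
        required for coning off.\<close>
      obtain a b where ab: "a \<in> \<sigma>" "b \<in> \<sigma>" "a \<noteq> b"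
        using \<sigma>(2) by (metis card_2_iff' card_le_Suc0_iff_eq f not_less_eq_eq le0 Suc_le_mono)
      then have "(\<lambda>v. if v = a then 1 else 0) \<in> B \<sigma>"
        using f by (auto simp: B_def simplex_points_def intro: bexI[of _ b])
      then have Bne: "B \<sigma> \<noteq> {}" by blast
      obtain F' c where F': "finite F'" "F' \<subseteq> A \<sigma>"
        "homotopic_with (\<lambda>_. True) (realization_topology (induced K F)) (realization_topology (induced K F')) id (\<lambda>_. c)"
        using null[OF \<sigma>(1) fF FA] by blast
      ultimately show ?thesis
        using extend_over_simplex[OF f Bne[unfolded B_def] fF, folded B_def, OF _ gB F'(3)] F' by blast
    qed
    then obtain e where e: "\<And>\<sigma>. \<sigma> \<in> L \<Longrightarrow> card \<sigma> = Suc (Suc n) \<Longrightarrow>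
        continuous_on (simplex_points \<sigma>) (e \<sigma>) \<and> (\<forall>x\<in>B \<sigma>. e \<sigma> x = g x) \<and>
        (\<exists>F. finite F \<and> F \<subseteq> A \<sigma> \<and> e \<sigma> ` simplex_points \<sigma> \<subseteq> realization (induced K F))"
      by metis
    \<comment> \<open>Only points carried by a simplex of \<open>L - K\<close> of the new dimension
      change their value. Points over \<open>K\<close> stay fixed, and boundary points have a
      smaller carrier and keep \<open>g\<close>, so the pieces \<open>e \<sigma>\<close> need no
      separate gluing argument.\<close>
    define g' where "g' x = (if supp x \<in> L - K \<and> card (supp x) = Suc (Suc n) then e (supp x) x else g x)" for x
    have g'K: "\<forall>x\<in>realization K. g' x = x"
      using suppK gK by (auto simp: g'_def realization_def)
    have g'eq: "g' x = g x" if "\<sigma> \<in> L" "card \<sigma> \<le> Suc n" "x \<in> simplex_points \<sigma>" for \<sigma> x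
    proof -
      have "card (supp x) \<le> card \<sigma>"
        using supp[OF that(1,3)] fin that(1) card_mono by blast
      then show ?thesis
        using that by (simp add: g'_def)
    qed
    have "good g' \<sigma>" if \<sigma>: "\<sigma> \<in> L" "card \<sigma> \<le> Suc (Suc n)" for \<sigma>
    proof -
      consider "\<sigma> \<in> K" | "card \<sigma> \<le> Suc n" | "\<sigma> \<notin> K" "card \<sigma> = Suc (Suc n)"
        using \<sigma> by linarith
      then show ?thesis
      proof cases
        case 1
        then show ?thesis using goodK g'K by blast
      next
        case 2
        then have eq: "g' x = g x" if "x \<in> simplex_points \<sigma>" for x
          using g'eq \<sigma> that by blast
        have "good g \<sigma>"
          using g 2 \<sigma> by (auto simp: P_def)
        then show ?thesis
          using eq by (rule goodcong)
      next
        case 3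
        have eq: "g' x = e \<sigma> x" if x: "x \<in> simplex_points \<sigma>" for x
        proof (cases "supp x = \<sigma>")
          case True
          then show ?thesis using 3 \<sigma> by (simp add: g'_def)
        next
          case False
          then have "supp x \<subset> \<sigma>"
            using supp[OF \<sigma>(1) x] by blast
          then have "x \<in> B \<sigma>"
            using x by (auto simp: B_def supp_def)
          moreover have "card (supp x) < Suc (Suc n)"
            using 3 psubset_card_mono[OF fin[OF \<sigma>(1)] \<open>supp x \<subset> \<sigma>\<close>] by simp
          ultimately show ?thesis
            using e[OF \<sigma>(1) 3(2)] by (simp add: g'_def)
        qed
        have "good (e \<sigma>) \<sigma>"
          using e[OF \<sigma>(1) 3(2)] by (simp add: good_def)
        then show ?thesis
          using eq by (rule goodcong)
      qed
    qed
    then have "P (Suc n) g'"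
      using g'K by (simp add: P_def)
    moreover have "Q n g g'"
      using g'eq by (auto simp: Q_def)
    ultimately show ?thesis by blast
  qed
  \<comment> \<open>On the 0-skeleton the identity works because every vertex of \<open>L\<close> is
    a vertex of \<open>K\<close>; the empty simplex has no points.\<close>
  have "P 0 id"
  proof -
    have "good id \<sigma>" if \<sigma>: "\<sigma> \<in> L" "card \<sigma> \<le> Suc 0" for \<sigma>
    proof (cases "\<sigma> = {}")
      case True
      then show ?thesis by (auto simp: good_def simplex_points_def)
    next
      case False
      then obtain v where "\<sigma> = {v}"
        using \<sigma> fin by (metis card_1_singletonE One_nat_def card_gt_0_iff le_antisym Suc_leI)
      then show ?thesis
        using goodK[of id] vert \<sigma> by simp
    qed
    then show ?thesis by (simp add: P_def)
  qed
  then obtain G where G: "\<And>n. P n (G n)" "\<And>n. Q n (G n) (G (Suc n))"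
    using dependent_nat_choice[of P Q] step by metis
  \<comment> \<open>The values have stabilized by this stage: stage \<open>n\<close> settles all
    carriers with at most \<open>Suc n\<close> vertices, so the index is one larger than necessary
    and avoids a subtraction.\<close>
  define g where "g x = G (card (supp x)) x" for x
  have Gk: "G (card (supp x) + k) x = g x" if "\<sigma> \<in> L" "x \<in> simplex_points \<sigma>" for \<sigma> x k
  proof (induction k)
    case (Suc k)
    have "card (supp x) \<le> Suc (card (supp x) + k)" by simp
    then have "G (Suc (card (supp x) + k)) x = G (card (supp x) + k) x"
      using G(2)[of "card (supp x) + k"] suppL[OF that] supp[OF that] unfolding Q_def by blast
    then show ?case using Suc by simp
  qed (simp add: g_def)
  have geq: "g x = G (card \<sigma>) x" if "\<sigma> \<in> L" "x \<in> simplex_points \<sigma>" for \<sigma> x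
  proof -
    have "card (supp x) \<le> card \<sigma>"
      using supp[OF that] fin that(1) card_mono by blast
    then show ?thesis
      using Gk[OF that, of "card \<sigma> - card (supp x)"] by simp
  qed
  have good: "good g \<sigma>" if \<sigma>: "\<sigma> \<in> L" for \<sigma>
  proof -
    have "good (G (card \<sigma>)) \<sigma>"
      using G(1)[of "card \<sigma>"] \<sigma> by (auto simp: P_def)
    then show ?thesis
      using geq[OF \<sigma>] by (rule goodcong)
  qed
  have gK: "g x = x" if "x \<in> realization K" for x
    using G(1)[of "card (supp x)"] that by (simp add: P_def g_def)
  have incl: "continuous_map (realization_topology K) (realization_topology L) id"
  proof (rule continuous_map_from_realization)
    fix \<sigma> assume \<sigma>: "\<sigma> \<in> K"
    show "continuous_map (top_of_set (simplex_points \<sigma>)) (realization_topology L) id"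
    proof (rule continuous_map_into_realization[of \<sigma>])
      show "id ` topspace (top_of_set (simplex_points \<sigma>)) \<subseteq> realization (induced L \<sigma>)"
        using \<sigma> KL by (auto intro!: realizationI[of \<sigma>] simp: induced_def)
    qed (use \<sigma> KL fin in auto)
  qed
  have cg: "continuous_map (realization_topology L) (realization_topology K) g"
  proof (rule continuous_map_from_realization)
    fix \<sigma> assume "\<sigma> \<in> L"
    from good[OF this] obtain F where F: "continuous_on (simplex_points \<sigma>) g" "finite F"
      "g ` simplex_points \<sigma> \<subseteq> realization (induced K F)"
      by (auto simp: good_def)
    then show "continuous_map (top_of_set (simplex_points \<sigma>)) (realization_topology K) g"
      by (intro continuous_map_into_realization[of F]) auto
  qed
  have "homotopic_with (\<lambda>_. True) (realization_topology K) (realization_topology K) (g \<circ> id) id"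
    by (rule homotopic_with_equal) (use gK continuous_map_compose[OF incl cg] in auto)
  moreover have "homotopic_with (\<lambda>_. True) (realization_topology L) (realization_topology L) (id \<circ> g) id"
  proof (rule homotopic_straight_line)
    fix \<sigma> assume \<sigma>: "\<sigma> \<in> L"
    from good[OF this] obtain F where F: "continuous_on (simplex_points \<sigma>) g" "finite F" "F \<subseteq> A \<sigma>"
      "g ` simplex_points \<sigma> \<subseteq> realization (induced K F)"
      by (auto simp: good_def)
    show "continuous_on (simplex_points \<sigma>) (id \<circ> g) \<and> continuous_on (simplex_points \<sigma>) id \<and>
      (\<exists>\<rho>\<in>L. (id \<circ> g) ` simplex_points \<sigma> \<subseteq> simplex_points \<rho> \<and> id ` simplex_points \<sigma> \<subseteq> simplex_points \<rho>)"
    proof (cases "\<sigma> = {}")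
      case True
      then show ?thesis using \<sigma> by (auto simp: simplex_points_def)
    next
      case False
      \<comment> \<open>Both \<open>x\<close> and \<open>g x\<close> lie in the simplex on
        \<open>F \<union> \<sigma>\<close>, which belongs to \<open>L\<close> because its vertices
        lie in \<open>A \<sigma>\<close>.\<close>
      have "F \<union> \<sigma> \<in> L"
        using full[OF \<sigma>, of "F \<union> \<sigma>"] F fin[OF \<sigma>] sub[OF \<sigma>] False by blast
      moreover have "simplex_points \<sigma> \<subseteq> simplex_points (F \<union> \<sigma>)"
        using F fin[OF \<sigma>] by (intro simplex_points_mono) auto
      moreover have "realization (induced K F) \<subseteq> simplex_points (F \<union> \<sigma>)"
        unfolding realization_def
      proof (rule UN_least)
        fix \<tau> assume "\<tau> \<in> induced K F"
        then show "simplex_points \<tau> \<subseteq> simplex_points (F \<union> \<sigma>)"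
          using F fin[OF \<sigma>] by (intro simplex_points_mono) (auto simp: induced_def)
      qed
      ultimately show ?thesis
        using F(1,4) by (intro conjI bexI[of _ "F \<union> \<sigma>"]) (auto simp del: Un_iff)
    qed
  qed (rule fin)
  ultimately show ?thesis
    using incl cg unfolding homotopy_equivalence_map_def by blast
qed

section \<open>Spaces with convex small balls\<close>

lemma mdist_self: "x \<in> mspace m \<Longrightarrow> mdist m x x = 0"
  by simp

text \<open>Quantifying over centers \<open>w\<close> makes every bound of the form "within
  \<open>r\<close> of \<open>w\<close>" pass from a simplex to its hull, and makes the hull
  monotone, without building a geodesic convex hull. A set contained in no r-ball has the whole
  space as its hull.\<close>

definition ball_hull :: "'a metric \<Rightarrow> real \<Rightarrow> 'a set \<Rightarrow> 'a set" where
  "ball_hull m r \<sigma> = {x \<in> mspace m. \<forall>w\<in>mspace m. (\<forall>a\<in>\<sigma>. mdist m w a < r) \<longrightarrow> mdist m w x < r}"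

lemma ball_hull_mono: "\<tau> \<subseteq> \<sigma> \<Longrightarrow> ball_hull m r \<tau> \<subseteq> ball_hull m r \<sigma>"
  by (auto simp: ball_hull_def)

lemma subset_ball_hull: "\<sigma> \<subseteq> mspace m \<Longrightarrow> \<sigma> \<subseteq> ball_hull m r \<sigma>"
  by (auto simp: ball_hull_def)

lemma ball_hullD:
  "x \<in> ball_hull m r \<sigma> \<Longrightarrow> w \<in> mspace m \<Longrightarrow> (\<And>a. a \<in> \<sigma> \<Longrightarrow> mdist m w a < r) \<Longrightarrow> mdist m w x < r"
  by (auto simp: ball_hull_def)

lemma ball_hull_subset_mspace: "ball_hull m r \<sigma> \<subseteq> mspace m"
  by (auto simp: ball_hull_def)

lemma cech_complex_iff:
  "\<sigma> \<in> cech_complex m r \<longleftrightarrow>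
    finite \<sigma> \<and> \<sigma> \<noteq> {} \<and> \<sigma> \<subseteq> mspace m \<and> (\<exists>w\<in>mspace m. \<forall>a\<in>\<sigma>. mdist m w a < r)"
proof -
  have "(\<Inter>a\<in>\<sigma>. mball_of m a r) \<noteq> {} \<longleftrightarrow> (\<exists>w\<in>mspace m. \<forall>a\<in>\<sigma>. mdist m w a < r)"
    if "\<sigma> \<noteq> {}" "\<sigma> \<subseteq> mspace m"
    using that unfolding ex_in_conv[symmetric] by (simp add: mdist_commute[of m _ _] subset_iff) blast
  then show ?thesis
    by (auto simp: cech_complex_def)
qed

text \<open>The definition is used twice: each vertex of the Rips simplex is a center of an r-ball
  containing it, so \<open>y\<close> is within \<open>r\<close> of every vertex; then
  \<open>y\<close> itself is such a center, so \<open>x\<close> is within \<open>r\<close> of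
  \<open>y\<close>.\<close>

lemma ball_hull_diam:
  assumes "\<sigma> \<in> rips_complex m r" "x \<in> ball_hull m r \<sigma>" "y \<in> ball_hull m r \<sigma>"
  shows "mdist m x y < r"
proof -
  have "mdist m y a < r" if "a \<in> \<sigma>" for a
    using ball_hullD[OF assms(3), of a] that assms(1)
    by (auto simp: rips_complex_def mdist_commute)
  then show ?thesis
    using ball_hullD[OF assms(2), of y] assms(3) by (auto simp: mdist_commute ball_hull_def)
qed

text \<open>Lengths up to \<open>2 * r\<close> occur because that bounds the distance of two points
  in a common r-ball. The center \<open>w\<close> in \<open>contraction\<close> records that the
  whole triangle sits in one such ball, which is what prevents it from surrounding a loop of a
  graph.\<close>

locale convex_small_balls =
  fixes m :: "'a metric" and r :: real
  assumes r_pos: "0 < r"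
    and ex_geodesic: "x \<in> mspace m \<Longrightarrow> y \<in> mspace m \<Longrightarrow> mdist m x y < 2 * r \<Longrightarrow> \<exists>\<gamma>. geodesic_seg m x y \<gamma>"
    and ball_convex: "u \<in> mspace m \<Longrightarrow> x \<in> mspace m \<Longrightarrow> y \<in> mspace m \<Longrightarrow> mdist m u x < r \<Longrightarrow> mdist m u y < r \<Longrightarrow>
      geodesic_seg m x y \<gamma> \<Longrightarrow> s \<in> {0..mdist m x y} \<Longrightarrow> mdist m u (\<gamma> s) < r"
    and contraction: "w \<in> mspace m \<Longrightarrow> z \<in> mspace m \<Longrightarrow> a \<in> mspace m \<Longrightarrow> b \<in> mspace m \<Longrightarrow>
      mdist m w z < r \<Longrightarrow> mdist m w a < r \<Longrightarrow> mdist m w b < r \<Longrightarrow>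
      geodesic_seg m z a \<gamma> \<Longrightarrow> geodesic_seg m z b \<gamma>' \<Longrightarrow> t \<in> {0..1} \<Longrightarrow>
      mdist m (\<gamma> (t * mdist m z a)) (\<gamma>' (t * mdist m z b)) \<le> mdist m a b"
begin

text \<open>An arbitrary chosen geodesic, with time rescaled to the unit interval. The choice is
  harmless, as \<open>ball_convex\<close> and \<open>contraction\<close> hold for all
  geodesics.\<close>

definition pt :: "'a \<Rightarrow> 'a \<Rightarrow> real \<Rightarrow> 'a" where
  "pt x y t = (SOME \<gamma>. geodesic_seg m x y \<gamma>) (t * mdist m x y)"

lemma geodesic_pt:
  assumes "x \<in> mspace m" "y \<in> mspace m" "mdist m x y < 2 * r"
  obtains \<gamma> where "geodesic_seg m x y \<gamma>" "\<And>t. pt x y t = \<gamma> (t * mdist m x y)"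
  using someI_ex[OF ex_geodesic[OF assms]] unfolding pt_def by blast

lemma pt_basic:
  assumes "x \<in> mspace m" "y \<in> mspace m" "mdist m x y < 2 * r"
  shows "pt x y 0 = x" "pt x y 1 = y"
    and "t \<in> {0..1} \<Longrightarrow> pt x y t \<in> mspace m"
    and "s \<in> {0..1} \<Longrightarrow> t \<in> {0..1} \<Longrightarrow> mdist m (pt x y s) (pt x y t) = \<bar>s - t\<bar> * mdist m x y"
proof -
  obtain \<gamma> where \<gamma>: "geodesic_seg m x y \<gamma>" "\<And>t. pt x y t = \<gamma> (t * mdist m x y)"
    using geodesic_pt[OF assms] by blast
  have I: "t * mdist m x y \<in> {0..mdist m x y}" if "t \<in> {0..1}" for t
    using that by (auto simp: mult_left_le_one_le)
  show "pt x y 0 = x" "pt x y 1 = y"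
    using \<gamma> by (auto simp: geodesic_seg_def)
  show "t \<in> {0..1} \<Longrightarrow> pt x y t \<in> mspace m"
    using \<gamma> I by (auto simp: geodesic_seg_def)
  show "mdist m (pt x y s) (pt x y t) = \<bar>s - t\<bar> * mdist m x y" if "s \<in> {0..1}" "t \<in> {0..1}"
  proof -
    have "mdist m (pt x y s) (pt x y t) = \<bar>s * mdist m x y - t * mdist m x y\<bar>"
      using \<gamma> I[OF that(1)] I[OF that(2)] by (simp add: geodesic_seg_def)
    also have "\<dots> = \<bar>s - t\<bar> * mdist m x y"
      by (simp add: abs_mult flip: left_diff_distrib)
    finally show ?thesis .
  qed
qed

lemma pt_ball:
  assumes "u \<in> mspace m" "x \<in> mspace m" "y \<in> mspace m" "mdist m u x < r" "mdist m u y < r" "t \<in> {0..1}"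
  shows "mdist m u (pt x y t) < r"
proof -
  have "mdist m x y < 2 * r"
    using mdist_triangle[of x m u y] assms by (simp add: mdist_commute)
  then obtain \<gamma> where \<gamma>: "geodesic_seg m x y \<gamma>" "\<And>t. pt x y t = \<gamma> (t * mdist m x y)"
    using geodesic_pt assms by blast
  show ?thesis
    unfolding \<gamma>(2) using assms by (intro ball_convex[OF _ _ _ _ _ \<gamma>(1)]) (auto simp: mult_left_le_one_le)
qed

text \<open>Slide along the geodesic to \<open>a\<close> from time \<open>s\<close> to time
  \<open>t\<close>, then compare the two geodesics at the same time \<open>t\<close>.\<close>

lemma pt_contraction:
  assumes "w \<in> mspace m" "z \<in> mspace m" "a \<in> mspace m" "b \<in> mspace m"
    "mdist m w z < r" "mdist m w a < r" "mdist m w b < r" "s \<in> {0..1}" "t \<in> {0..1}"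
  shows "mdist m (pt z a s) (pt z b t) \<le> \<bar>s - t\<bar> * mdist m z a + mdist m a b"
proof -
  have d: "mdist m z a < 2 * r" "mdist m z b < 2 * r"
    using mdist_triangle[of z m w a] mdist_triangle[of z m w b] assms by (simp_all add: mdist_commute)
  obtain \<gamma> where \<gamma>: "geodesic_seg m z a \<gamma>" "\<And>t. pt z a t = \<gamma> (t * mdist m z a)"
    using geodesic_pt d assms by blast
  obtain \<gamma>' where \<gamma>': "geodesic_seg m z b \<gamma>'" "\<And>t. pt z b t = \<gamma>' (t * mdist m z b)"
    using geodesic_pt d assms by blast
  have "mdist m (pt z a s) (pt z b t) \<le> mdist m (pt z a s) (pt z a t) + mdist m (pt z a t) (pt z b t)"
    using assms d by (intro mdist_triangle pt_basic) auto
  moreover have "mdist m (pt z a s) (pt z a t) = \<bar>s - t\<bar> * mdist m z a"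
    using assms d by (intro pt_basic) auto
  moreover have "mdist m (pt z a t) (pt z b t) \<le> mdist m a b"
    unfolding \<gamma>(2) \<gamma>'(2) using assms by (intro contraction[OF _ _ _ _ _ _ _ \<gamma>(1) \<gamma>'(1)]) auto
  ultimately show ?thesis by simp
qed

text \<open>Every r-ball around \<open>\<sigma>\<close> contains the vertex \<open>z\<close> and the
  hull point \<open>a\<close>, hence by convexity the geodesic between them.\<close>

lemma pt_ball_hull:
  assumes "\<sigma> \<subseteq> mspace m" "z \<in> \<sigma>" "a \<in> ball_hull m r \<sigma>" "mdist m z a < 2 * r" "t \<in> {0..1}"
  shows "pt z a t \<in> ball_hull m r \<sigma>"
  using assms pt_ball[of _ z a t] pt_basic(3)[of z a t] unfolding ball_hull_def by auto

text \<open>Contraction towards \<open>z\<close> never leaves the hull, so only \<open>slack\<close>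
  depends on the complex: short time steps must keep simplices contiguous.\<close>

lemma nullhomotopic_ball_hull:
  assumes K: "\<And>\<tau>. \<tau> \<in> K \<Longrightarrow> finite \<tau>" and \<sigma>: "\<sigma> \<subseteq> mspace m" "z \<in> \<sigma>"
    and F: "finite F" "F \<subseteq> ball_hull m r \<sigma>" and d: "\<And>a. a \<in> ball_hull m r \<sigma> \<Longrightarrow> mdist m z a < 2 * r"
    and slack: "\<And>\<tau>. \<tau> \<in> K \<Longrightarrow> \<tau> \<subseteq> F \<Longrightarrow>
      \<exists>\<delta>>0. \<forall>s\<in>{0..1}. \<forall>t\<in>{0..1}. \<bar>s - t\<bar> < \<delta> \<longrightarrow> (\<lambda>a. pt z a s) ` \<tau> \<union> (\<lambda>a. pt z a t) ` \<tau> \<in> K"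
  shows "\<exists>F' c. finite F' \<and> F' \<subseteq> ball_hull m r \<sigma> \<and>
    homotopic_with (\<lambda>_. True) (realization_topology (induced K F)) (realization_topology (induced K F')) id (\<lambda>_. c)"
proof (rule nullhomotopic_induced[where p = "\<lambda>t a. pt z a t" and z = z, OF F(1) K])
  have FH: "a \<in> ball_hull m r \<sigma>" if "a \<in> F" for a
    using that F(2) by blast
  then have FM: "a \<in> mspace m" "mdist m z a < 2 * r" if "a \<in> F" for a
    using that d ball_hull_subset_mspace[of m r \<sigma>] by auto
  have zM: "z \<in> mspace m" using \<sigma> by blast
  show "pt z a 1 = a" "pt z a 0 = z" if "a \<in> F" for a
    using pt_basic(1,2)[OF zM FM[OF that]] by auto
  show "pt z a t \<in> ball_hull m r \<sigma>" if "t \<in> {0..1}" "a \<in> F" for t a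
    using that FM(2) FH \<sigma> by (intro pt_ball_hull) auto
qed (rule slack | assumption)+

text \<open>Finitely many strict inequalities have a common margin. It is measured in time: under
  contraction a point moves at speed below \<open>2 * r\<close>.\<close>

lemma ex_uniform_slack:
  assumes "finite S" "\<And>x. x \<in> S \<Longrightarrow> f x < (c::real)"
  obtains \<delta> where "\<delta> > 0" "\<And>x. x \<in> S \<Longrightarrow> f x + 2 * r * \<delta> \<le> c"
proof -
  define e where "e = Min (insert 1 ((\<lambda>x. c - f x) ` S))"
  have "e > 0"
    using assms by (auto simp: e_def)
  moreover have "e \<le> c - f x" if "x \<in> S" for x
    using that assms by (simp add: e_def)
  ultimately show thesis
    using r_pos by (intro that[of "e / (2 * r)"]) (auto simp: algebra_simps)
qed

section \<open>The two inclusions\<close>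

text \<open>The center certifying a Cech simplex is contracted along with the vertices:
  \<open>pt z w t\<close> certifies their images at time \<open>t\<close>, and also at a nearby time
  \<open>s\<close>, the lag being absorbed by the margin below \<open>r / 2\<close>.\<close>

lemma cech_rips_equivalence:
  "homotopy_equivalence_map (realization_topology (cech_complex m (r / 2))) (realization_topology (rips_complex m r)) id"
proof (rule homotopy_equivalence_inclusion[where A = "ball_hull m r"])
  show "cech_complex m (r / 2) \<subseteq> rips_complex m r"
  proof
    fix \<sigma> assume "\<sigma> \<in> cech_complex m (r / 2)"
    then obtain w where w: "finite \<sigma>" "\<sigma> \<noteq> {}" "\<sigma> \<subseteq> mspace m" "w \<in> mspace m" "\<And>a. a \<in> \<sigma> \<Longrightarrow> mdist m w a < r / 2"
      by (auto simp: cech_complex_iff)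
    have "mdist m a b < r" if "a \<in> \<sigma>" "b \<in> \<sigma>" for a b
      using mdist_triangle[of a m w b] w(5)[OF that(1)] w(5)[OF that(2)] w(3,4) that
      by (simp add: mdist_commute subset_iff)
    then show "\<sigma> \<in> rips_complex m r"
      using w by (auto simp: rips_complex_def)
  qed
  fix \<sigma> assume \<sigma>: "\<sigma> \<in> rips_complex m r"
  then have \<sigma>M: "\<sigma> \<subseteq> mspace m"
    by (simp add: rips_complex_def)
  show "finite \<sigma>" "\<sigma> \<subseteq> ball_hull m r \<sigma>"
    using \<sigma> subset_ball_hull[OF \<sigma>M] by (auto simp: rips_complex_def)
  show "\<tau> \<in> rips_complex m r" if "\<tau> \<subseteq> \<sigma>" "\<tau> \<noteq> {}" for \<tau>
    using \<sigma> that by (auto simp: rips_complex_def intro: finite_subset)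
  show "\<tau> \<in> rips_complex m r" if "finite \<tau>" "\<tau> \<noteq> {}" "\<tau> \<subseteq> ball_hull m r \<sigma>" for \<tau>
    using that ball_hull_diam[OF \<sigma>] ball_hull_subset_mspace[of m r \<sigma>]
    unfolding rips_complex_def by blast
  show "ball_hull m r \<tau> \<subseteq> ball_hull m r \<sigma>" if "\<tau> \<subseteq> \<sigma>" for \<tau>
    using that by (rule ball_hull_mono)
  fix F assume F: "finite F" "F \<subseteq> ball_hull m r \<sigma>"
  obtain z where z: "z \<in> \<sigma>"
    using \<sigma> by (auto simp: rips_complex_def)
  then have zM: "z \<in> mspace m" and zH: "z \<in> ball_hull m r \<sigma>"
    using \<sigma>M subset_ball_hull by blast+
  have d: "mdist m z a < r" if "a \<in> ball_hull m r \<sigma>" for a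
    using ball_hull_diam[OF \<sigma> zH that] .
  show "\<exists>F' c. finite F' \<and> F' \<subseteq> ball_hull m r \<sigma> \<and>
    homotopic_with (\<lambda>_. True) (realization_topology (induced (cech_complex m (r/2)) F))
      (realization_topology (induced (cech_complex m (r/2)) F')) id (\<lambda>_. c)"
  proof (rule nullhomotopic_ball_hull[OF _ \<sigma>M z F])
    show "finite \<tau>" if "\<tau> \<in> cech_complex m (r/2)" for \<tau>
      using that by (simp add: cech_complex_iff)
    show "mdist m z a < 2 * r" if "a \<in> ball_hull m r \<sigma>" for a
      using d[OF that] r_pos by simp
    fix \<tau> assume "\<tau> \<in> cech_complex m (r/2)" and \<tau>F: "\<tau> \<subseteq> F"
    then obtain w where \<tau>: "finite \<tau>" "\<tau> \<noteq> {}" "\<tau> \<subseteq> mspace m" and w: "w \<in> mspace m" "\<And>a. a \<in> \<tau> \<Longrightarrow> mdist m w a < r / 2"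
      by (auto simp: cech_complex_iff)
    obtain \<delta> where \<delta>: "\<delta> > 0" "\<And>a. a \<in> \<tau> \<Longrightarrow> mdist m w a + 2 * r * \<delta> \<le> r / 2"
      using ex_uniform_slack[OF \<tau>(1), of "mdist m w" "r / 2"] w(2) by blast
    have a\<tau>: "a \<in> mspace m" "mdist m z a < r" if "a \<in> \<tau>" for a
      using that \<tau> \<tau>F F d by blast+
    \<comment> \<open>The center \<open>w\<close> need not lie in the hull; going through a vertex
      of \<open>\<tau>\<close> bounds its distance from \<open>z\<close> by
      \<open>r + r / 2\<close>.\<close>
    have dzw: "mdist m z w < 2 * r"
    proof -
      obtain a where a: "a \<in> \<tau>" using \<tau> by blast
      then show ?thesis
        using mdist_triangle[of z m a w] zM w(1) a\<tau>[OF a] w(2)[OF a] r_pos by (simp add: mdist_commute)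
    qed
    have near: "mdist m (pt z w t) (pt z a s) < r / 2"
      if "a \<in> \<tau>" "s \<in> {0..1}" "t \<in> {0..1}" "\<bar>s - t\<bar> < \<delta>" for a s t
    proof -
      have aa: "mdist m a a < r"
        using a\<tau>[OF that(1)] r_pos by (simp add: mdist_self)
      \<comment> \<open>The ball holding the triangle \<open>z\<close>, \<open>a\<close>,
        \<open>w\<close> is the one around \<open>a\<close> itself.\<close>
      have "mdist m (pt z a s) (pt z w t) \<le> \<bar>s - t\<bar> * mdist m z a + mdist m a w"
        using that a\<tau>[OF that(1)] w(1) w(2)[OF that(1)] zM r_pos aa
        by (intro pt_contraction[of a]) (auto simp: mdist_commute)
      moreover have "\<bar>s - t\<bar> * mdist m z a \<le> \<delta> * r"
        using that a\<tau>[OF that(1)] \<delta>(1) by (intro mult_mono) auto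
      moreover have "r * \<delta> > 0"
        using \<delta>(1) r_pos by simp
      ultimately show ?thesis
        using \<delta>(2)[OF that(1)] by (simp add: mdist_commute mult.commute)
    qed
    have "(\<lambda>a. pt z a s) ` \<tau> \<union> (\<lambda>a. pt z a t) ` \<tau> \<in> cech_complex m (r/2)"
      if st: "s \<in> {0..1}" "t \<in> {0..1}" "\<bar>s - t\<bar> < \<delta>" for s t
      unfolding cech_complex_iff
    proof (intro conjI bexI[of _ "pt z w t"] ballI)
      have M: "pt z a u \<in> mspace m" if "a \<in> \<tau>" "u \<in> {0..1}" for a u
        using a\<tau>[OF that(1)] zM r_pos that(2) by (intro pt_basic) auto
      then show "(\<lambda>a. pt z a s) ` \<tau> \<union> (\<lambda>a. pt z a t) ` \<tau> \<subseteq> mspace m"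
        using st by blast
      show "pt z w t \<in> mspace m"
        using st zM w dzw by (intro pt_basic) auto
      show "mdist m (pt z w t) x < r / 2" if "x \<in> (\<lambda>a. pt z a s) ` \<tau> \<union> (\<lambda>a. pt z a t) ` \<tau>" for x
        using that near st \<delta>(1) by auto
    qed (use \<tau> in auto)
    then show "\<exists>\<delta>>0. \<forall>s\<in>{0..1}. \<forall>t\<in>{0..1}. \<bar>s - t\<bar> < \<delta> \<longrightarrow>
      (\<lambda>a. pt z a s) ` \<tau> \<union> (\<lambda>a. pt z a t) ` \<tau> \<in> cech_complex m (r/2)"
      using \<delta>(1) by blast
  qed
next
  show "\<tau> \<in> cech_complex m (r/2)" if "\<sigma> \<in> cech_complex m (r/2)" "\<tau> \<subseteq> \<sigma>" "\<tau> \<noteq> {}" for \<sigma> \<tau>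
    using that unfolding cech_complex_iff by (meson finite_subset subsetD subset_trans)
  show "{v} \<in> cech_complex m (r/2)" if "{v} \<in> rips_complex m r" for v
    using that r_pos by (auto simp: cech_complex_iff rips_complex_def mdist_self intro!: bexI[of _ v])
qed

text \<open>Any vertex of a Rips simplex certifies it as a Cech simplex of radius \<open>r\<close>.
  Here the hull is only known to lie in an r-ball around some \<open>w\<close>, so its points may be
  almost \<open>2 * r\<close> apart; contraction relative to \<open>w\<close> still does not
  increase distances between vertices.\<close>

lemma rips_cech_equivalence:
  "homotopy_equivalence_map (realization_topology (rips_complex m r)) (realization_topology (cech_complex m r)) id"
proof (rule homotopy_equivalence_inclusion[where A = "ball_hull m r"])
  show "rips_complex m r \<subseteq> cech_complex m r"
  proof
    show "\<sigma> \<in> cech_complex m r" if "\<sigma> \<in> rips_complex m r" for \<sigma>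
      using that unfolding cech_complex_iff rips_complex_def by blast
  qed
  fix \<sigma> assume \<sigma>: "\<sigma> \<in> cech_complex m r"
  then obtain w where \<sigma>M: "\<sigma> \<subseteq> mspace m" and w: "w \<in> mspace m" "\<And>a. a \<in> \<sigma> \<Longrightarrow> mdist m w a < r"
    by (auto simp: cech_complex_iff)
  have wH: "mdist m w a < r" if "a \<in> ball_hull m r \<sigma>" for a
    using ball_hullD[OF that w] .
  show "finite \<sigma>" "\<sigma> \<subseteq> ball_hull m r \<sigma>"
    using \<sigma> subset_ball_hull[OF \<sigma>M] by (auto simp: cech_complex_iff)
  show "\<tau> \<in> cech_complex m r" if "\<tau> \<subseteq> \<sigma>" "\<tau> \<noteq> {}" for \<tau>
    using \<sigma> that unfolding cech_complex_iff by (meson finite_subset subsetD subset_trans)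
  show "\<tau> \<in> cech_complex m r" if "finite \<tau>" "\<tau> \<noteq> {}" "\<tau> \<subseteq> ball_hull m r \<sigma>" for \<tau>
    using that w(1) wH ball_hull_subset_mspace[of m r \<sigma>] unfolding cech_complex_iff by blast
  show "ball_hull m r \<tau> \<subseteq> ball_hull m r \<sigma>" if "\<tau> \<subseteq> \<sigma>" for \<tau>
    using that by (rule ball_hull_mono)
  fix F assume F: "finite F" "F \<subseteq> ball_hull m r \<sigma>"
  obtain z where z: "z \<in> \<sigma>"
    using \<sigma> by (auto simp: cech_complex_iff)
  then have zM: "z \<in> mspace m" and zH: "z \<in> ball_hull m r \<sigma>"
    using \<sigma>M subset_ball_hull by blast+
  have d: "mdist m z a < 2 * r" if "a \<in> ball_hull m r \<sigma>" for a
    using mdist_triangle[of z m w a] zM w(1) wH[OF that] wH[OF zH] ball_hull_subset_mspace[of m r \<sigma>] that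
    by (simp add: mdist_commute subset_iff)
  show "\<exists>F' c. finite F' \<and> F' \<subseteq> ball_hull m r \<sigma> \<and>
    homotopic_with (\<lambda>_. True) (realization_topology (induced (rips_complex m r) F))
      (realization_topology (induced (rips_complex m r) F')) id (\<lambda>_. c)"
  proof (rule nullhomotopic_ball_hull[OF _ \<sigma>M z F d])
    show "finite \<tau>" if "\<tau> \<in> rips_complex m r" for \<tau>
      using that by (simp add: rips_complex_def)
    fix \<tau> assume "\<tau> \<in> rips_complex m r" and \<tau>F: "\<tau> \<subseteq> F"
    then have \<tau>: "finite \<tau>" "\<tau> \<noteq> {}" "\<tau> \<subseteq> mspace m" and \<tau>d: "\<And>a b. a \<in> \<tau> \<Longrightarrow> b \<in> \<tau> \<Longrightarrow> mdist m a b < r"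
      by (auto simp: rips_complex_def)
    have "(case p of (a, b) \<Rightarrow> mdist m a b) < r" if "p \<in> \<tau> \<times> \<tau>" for p
      using \<tau>d that by auto
    then obtain \<delta> where \<delta>: "\<delta> > 0"
      and \<delta>': "\<And>p. p \<in> \<tau> \<times> \<tau> \<Longrightarrow> (case p of (a, b) \<Rightarrow> mdist m a b) + 2 * r * \<delta> \<le> r"
      using ex_uniform_slack[of "\<tau> \<times> \<tau>" "\<lambda>(a, b). mdist m a b" r] \<tau>(1) by (metis finite_cartesian_product)
    have a\<tau>: "a \<in> mspace m" "a \<in> ball_hull m r \<sigma>" if "a \<in> \<tau>" for a
      using that \<tau> \<tau>F F by blast+
    have near: "mdist m (pt z a s) (pt z b t) < r"
      if "a \<in> \<tau>" "b \<in> \<tau>" "s \<in> {0..1}" "t \<in> {0..1}" "\<bar>s - t\<bar> < \<delta>" for a b s t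
    proof -
      have "mdist m (pt z a s) (pt z b t) \<le> \<bar>s - t\<bar> * mdist m z a + mdist m a b"
        using that a\<tau> w(1) wH zM zH by (intro pt_contraction[of w]) auto
      moreover have "\<bar>s - t\<bar> * mdist m z a < 2 * r * \<delta>"
      proof (cases "s = t")
        case False
        then have "\<bar>s - t\<bar> * mdist m z a < \<delta> * (2 * r)"
          using that d[OF a\<tau>(2)[OF that(1)]] by (intro mult_strict_mono) auto
        then show ?thesis by (simp add: mult_ac)
      qed (use \<delta> r_pos in simp)
      ultimately show ?thesis
        using \<delta>'[of "(a, b)"] that by simp
    qed
    have "(\<lambda>a. pt z a s) ` \<tau> \<union> (\<lambda>a. pt z a t) ` \<tau> \<in> rips_complex m r"
      if st: "s \<in> {0..1}" "t \<in> {0..1}" "\<bar>s - t\<bar> < \<delta>" for s t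
    proof -
      have "pt z a u \<in> mspace m" if "a \<in> \<tau>" "u \<in> {0..1}" for a u
        using a\<tau>[OF that(1)] zM d that(2) by (intro pt_basic) auto
      moreover have "\<bar>t - s\<bar> < \<delta>"
        using st(3) by linarith
      ultimately show ?thesis
        using \<tau> st \<delta> near unfolding rips_complex_def by auto
    qed
    then show "\<exists>\<delta>>0. \<forall>s\<in>{0..1}. \<forall>t\<in>{0..1}. \<bar>s - t\<bar> < \<delta> \<longrightarrow>
      (\<lambda>a. pt z a s) ` \<tau> \<union> (\<lambda>a. pt z a t) ` \<tau> \<in> rips_complex m r"
      using \<delta> by blast
  qed
next
  show "\<tau> \<in> rips_complex m r" if "\<sigma> \<in> rips_complex m r" "\<tau> \<subseteq> \<sigma>" "\<tau> \<noteq> {}" for \<sigma> \<tau>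
    using that by (auto simp: rips_complex_def intro: finite_subset)
  show "{v} \<in> rips_complex m r" if "{v} \<in> cech_complex m r" for v
    using that r_pos by (auto simp: cech_complex_iff rips_complex_def mdist_self)
qed

end

section \<open>Positive convexity radius\<close>

text \<open>The supremum need not be attained, so each use picks some \<open>\<rho>\<close>
  satisfying the conditions and exceeding the distances at hand. These are all below
  \<open>2 * r\<close>, which accounts for the bound r(X)/2.\<close>

lemma convex_small_balls_convexity_radius:
  assumes r: "0 < r" and rad: "2 * ereal r \<le> convexity_radius m"
  shows "convex_small_balls m r"
proof -
  have ex: "\<exists>\<rho>. convexity_conditions m \<rho> \<and> s < \<rho>" if "s < 2 * r" for s
  proof -
    have "ereal s < convexity_radius m"
      using that rad by (metis ereal_less_eq(3) less_le_trans linorder_not_le ereal_times(1) numeral_eq_ereal times_ereal.simps(1))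
    then show ?thesis
      by (auto simp: convexity_radius_def less_Sup_iff)
  qed
  show ?thesis
  proof
    show "0 < r" by (rule r)
    show "\<exists>\<gamma>. geodesic_seg m x y \<gamma>" if h: "x \<in> mspace m" "y \<in> mspace m" "mdist m x y < 2 * r" for x y
    proof -
      obtain \<rho> where \<rho>: "convexity_conditions m \<rho>" "mdist m x y / 2 < \<rho>"
        using ex[of "mdist m x y / 2"] h(3) r by auto
      then have "unique_geodesic m x y"
        using that unfolding convexity_conditions_def by auto
      then show ?thesis by (simp add: unique_geodesic_def)
    qed
    show "mdist m u (\<gamma> s) < r"
      if h: "u \<in> mspace m" "x \<in> mspace m" "y \<in> mspace m" "mdist m u x < r" "mdist m u y < r"
        "geodesic_seg m x y \<gamma>" "s \<in> {0..mdist m x y}" for u x y \<gamma> s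
    proof -
      have "mdist m x y < 2 * r"
        using mdist_triangle[of x m u y] h by (simp add: mdist_commute)
      then obtain \<rho> where \<rho>: "convexity_conditions m \<rho>" "max r (mdist m x y) < \<rho>"
        using ex[of "max r (mdist m x y)"] r by auto
      have "mdist m u (\<gamma> s) \<le> max (mdist m u x) (mdist m u y)"
      proof -
        have "mdist m x y < \<rho> \<and> mdist m u x < \<rho> \<and> mdist m u y < \<rho> \<and>
          geodesic_seg m x y \<gamma> \<and> \<gamma> s \<in> \<gamma> ` {0..mdist m x y}"
          using \<rho>(2) h by auto
        then show ?thesis
          using \<rho>(1) h(1-3) unfolding convexity_conditions_def by blast
      qed
      then show ?thesis using h by simp
    qed
    show "mdist m (\<gamma> (t * mdist m z a)) (\<gamma>' (t * mdist m z b)) \<le> mdist m a b"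
      if h: "w \<in> mspace m" "z \<in> mspace m" "a \<in> mspace m" "b \<in> mspace m"
        "mdist m w z < r" "mdist m w a < r" "mdist m w b < r"
        "geodesic_seg m z a \<gamma>" "geodesic_seg m z b \<gamma>'" "t \<in> {0..1}" for w z a b \<gamma> \<gamma>' t
    \<comment> \<open>The third convexity condition covers only \<open>t < 1\<close>; at
      \<open>t = 1\<close> both sides coincide.\<close>
    proof (cases "t = 1")
      case True
      then show ?thesis using h by (simp add: geodesic_seg_def)
    next
      case False
      have "mdist m z a < 2 * r" "mdist m z b < 2 * r"
        using mdist_triangle[of z m w a] mdist_triangle[of z m w b] h by (simp_all add: mdist_commute)
      then obtain \<rho> where \<rho>: "convexity_conditions m \<rho>" "max (mdist m z a) (mdist m z b) < \<rho>"
        using ex[of "max (mdist m z a) (mdist m z b)"] by auto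
      have "isometric_on m \<gamma> (mdist m z a) \<and> isometric_on m \<gamma>' (mdist m z b) \<and> \<gamma> 0 = \<gamma>' 0 \<and>
        0 \<le> mdist m z a \<and> mdist m z a < \<rho> \<and> 0 \<le> mdist m z b \<and> mdist m z b < \<rho> \<and> 0 \<le> t \<and> t < 1"
        using h False \<rho>(2) by (auto simp: isometric_on_def geodesic_seg_def)
      then have "mdist m (\<gamma> (t * mdist m z a)) (\<gamma>' (t * mdist m z b)) \<le> mdist m (\<gamma> (mdist m z a)) (\<gamma>' (mdist m z b))"
        using \<rho>(1) unfolding convexity_conditions_def by blast
      then show ?thesis
        using h by (simp add: geodesic_seg_def)
    qed
  qed
qed

section \<open>Geodesics\<close>

lemma closedin_mtopology_compact:
  assumes "compactin (mtopology_of m) S"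
  shows "closedin (mtopology_of m) S"
  using assms Metric_space.Hausdorff_space_mtopology[OF Metric_space_mspace_mdist]
  by (auto simp: mtopology_of_def intro: compactin_imp_closedin)

lemma continuous_map_nonexpansive:
  assumes M: "\<And>s. s \<in> S \<Longrightarrow> c s \<in> mspace m"
    and d: "\<And>s t. s \<in> S \<Longrightarrow> t \<in> S \<Longrightarrow> mdist m (c s) (c t) \<le> \<bar>s - t\<bar>"
  shows "continuous_map (top_of_set (S :: real set)) (mtopology_of m) c"
  unfolding mtopology_of_def Metric_space.continuous_map_to_metric[OF Metric_space_mspace_mdist]
proof (intro ballI allI impI)
  fix s \<epsilon> :: real assume s: "s \<in> topspace (top_of_set S)" "0 < \<epsilon>"
  have "c t \<in> Metric_space.mball (mspace m) (mdist m) (c s) \<epsilon>" if "t \<in> S \<inter> ball s \<epsilon>" for t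
    using d[of s t] M[of s] M[of t] s that
    by (auto simp: Metric_space.in_mball[OF Metric_space_mspace_mdist] dist_real_def)
  then show "\<exists>U. openin (top_of_set S) U \<and> s \<in> U \<and>
      (\<forall>t\<in>U. c t \<in> Metric_space.mball (mspace m) (mdist m) (c s) \<epsilon>)"
    using s by (intro exI[of _ "S \<inter> ball s \<epsilon>"]) (auto intro: openin_open_Int)
qed

lemma closedin_image_compact:
  assumes "continuous_map (top_of_set S) (mtopology_of m) c" "compact S"
  shows "closedin (mtopology_of m) (c ` S)"
  using image_compactin[OF _ assms(1), of S] assms(2)
  by (intro closedin_mtopology_compact) (simp add: compactin_subtopology)

lemma curve_length_ge_polygon:
  assumes "t 0 = a" "t n = b" "\<And>i. i < n \<Longrightarrow> t i \<le> t (Suc i)"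
  shows "ereal (\<Sum>i<n. mdist m (g (t i)) (g (t (Suc i)))) \<le> curve_length m g a b"
  unfolding curve_length_def using assms by (intro Sup_upper) blast

lemma curve_length_ge_mdist:
  assumes "a \<le> b"
  shows "ereal (mdist m (g a) (g b)) \<le> curve_length m g a b"
  using curve_length_ge_polygon[of "\<lambda>i. if i = 0 then a else b" a 1 b m g] assms by simp

lemma curve_length_ge_mdist3:
  assumes "a \<le> s" "s \<le> t" "t \<le> b"
  shows "ereal (mdist m (g a) (g s) + mdist m (g s) (g t) + mdist m (g t) (g b)) \<le> curve_length m g a b"
proof -
  define p where "p i = (if i = 0 then a else if i = 1 then s else if i = 2 then t else b)" for i :: nat
  have "ereal (\<Sum>i<3. mdist m (g (p i)) (g (p (Suc i)))) \<le> curve_length m g a b"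
    using assms by (intro curve_length_ge_polygon) (auto simp: p_def)
  then show ?thesis
    by (simp add: p_def numeral_3_eq_3)
qed

lemma curve_length_le:
  assumes "\<And>s t. a \<le> s \<Longrightarrow> s \<le> t \<Longrightarrow> t \<le> b \<Longrightarrow> mdist m (g s) (g t) \<le> C * (t - s)"
  shows "curve_length m g a b \<le> ereal (C * (b - a))"
  unfolding curve_length_def
proof (rule Sup_least, clarify)
  fix n and t :: "nat \<Rightarrow> real"
  assume t: "a = t 0" "b = t n" "\<forall>i<n. t i \<le> t (Suc i)"
  have mono: "t i \<le> t j" if "i \<le> j" "j \<le> n" for i j
    using that t(3) by (induction j) (auto simp: le_Suc_eq intro: order_trans)
  have "(\<Sum>i<n. mdist m (g (t i)) (g (t (Suc i)))) \<le> (\<Sum>i<n. C * (t (Suc i) - t i))"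
    using t mono by (intro sum_mono assms) auto
  also have "\<dots> = C * (t n - t 0)"
    by (simp add: sum_lessThan_telescope flip: sum_distrib_left)
  finally show "ereal (\<Sum>i<n. mdist m (g (t i)) (g (t (Suc i)))) \<le> ereal (C * (t n - t 0))"
    by simp
qed

lemma geodesic_segD:
  assumes "geodesic_seg m x y \<gamma>"
  shows "\<gamma> 0 = x" "\<gamma> (mdist m x y) = y" "s \<in> {0..mdist m x y} \<Longrightarrow> \<gamma> s \<in> mspace m"
    "s \<in> {0..mdist m x y} \<Longrightarrow> t \<in> {0..mdist m x y} \<Longrightarrow> mdist m (\<gamma> s) (\<gamma> t) = \<bar>s - t\<bar>"
    "s \<in> {0..mdist m x y} \<Longrightarrow> mdist m x (\<gamma> s) = s"
    "s \<in> {0..mdist m x y} \<Longrightarrow> mdist m (\<gamma> s) y = mdist m x y - s"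
proof -
  show 1: "\<gamma> 0 = x" "\<gamma> (mdist m x y) = y" "s \<in> {0..mdist m x y} \<Longrightarrow> \<gamma> s \<in> mspace m"
    using assms by (auto simp: geodesic_seg_def)
  show 2: "s \<in> {0..mdist m x y} \<Longrightarrow> t \<in> {0..mdist m x y} \<Longrightarrow> mdist m (\<gamma> s) (\<gamma> t) = \<bar>s - t\<bar>" for s t
    using assms by (auto simp: geodesic_seg_def)
  show "s \<in> {0..mdist m x y} \<Longrightarrow> mdist m x (\<gamma> s) = s"
    using 2[of 0 s] 1 by simp
  show "s \<in> {0..mdist m x y} \<Longrightarrow> mdist m (\<gamma> s) y = mdist m x y - s"
    using 2[of s "mdist m x y"] 1 by simp
qed

lemma geodesic_seg_reverse:
  assumes "geodesic_seg m x y \<gamma>"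
  shows "geodesic_seg m y x (\<lambda>s. \<gamma> (mdist m x y - s))"
  using assms unfolding geodesic_seg_def mdist_commute[of m y x] by auto

lemma geodesic_seg_const: "x \<in> mspace m \<Longrightarrow> geodesic_seg m x x (\<lambda>_. x)"
  by (simp add: geodesic_seg_def mdist_self)

lemma continuous_map_geodesic:
  assumes "geodesic_seg m x y \<gamma>"
  shows "continuous_map (top_of_set {0..mdist m x y}) (mtopology_of m) \<gamma>"
  using geodesic_segD[OF assms] by (intro continuous_map_nonexpansive) auto

lemma closedin_geodesic:
  "geodesic_seg m x y \<gamma> \<Longrightarrow> closedin (mtopology_of m) (\<gamma> ` {0..mdist m x y})"
  by (intro closedin_image_compact continuous_map_geodesic) auto

text \<open>A path whose length is the distance of its end points is reparametrized by the distance
  from its starting point.\<close>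
lemma geodesic_space_geodesic_seg:
  assumes "geodesic_space m" "x \<in> mspace m" "y \<in> mspace m"
  shows "\<exists>\<gamma>. geodesic_seg m x y \<gamma>"
proof -
  obtain g where g: "is_path_in m g" "g 0 = x" "g 1 = y" "curve_length m g 0 1 = ereal (mdist m x y)"
    using assms unfolding geodesic_space_def by blast
  have gM: "g t \<in> mspace m" if "t \<in> {0..1}" for t
    using g(1) that continuous_map_image_subset_topspace[of "top_of_set {0..1}" "mtopology_of m" g]
    unfolding is_path_in_def by auto
  define \<phi> where "\<phi> t = mdist m x (g t)" for t
  have tri: "\<phi> s + mdist m (g s) (g t) + mdist m (g t) y \<le> mdist m x y" if "0 \<le> s" "s \<le> t" "t \<le> 1" for s t
    using curve_length_ge_mdist3[OF that, of m g] g by (simp add: \<phi>_def)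
  \<comment> \<open>The length leaves no slack: \<open>tri\<close> bounds the distance by the
    difference of \<open>\<phi>\<close>, and the triangle inequality gives the reverse.\<close>
  have dist: "mdist m (g s) (g t) = \<phi> t - \<phi> s" if "0 \<le> s" "s \<le> t" "t \<le> 1" for s t
    using tri[OF that] mdist_triangle[of x m "g t" y] mdist_triangle[of x m "g s" "g t"] assms gM[of s] gM[of t] that
    by (simp add: \<phi>_def)
  have "continuous_map (top_of_set {0..1}) euclidean (mdist m x \<circ> g)"
    using continuous_map_compose[OF g(1)[unfolded is_path_in_def] continuous_on_mdist[OF assms(2)]] .
  then have cont: "continuous_on {0..1} \<phi>"
    by (simp add: \<phi>_def o_def)
  \<comment> \<open>The path may pause, so \<open>\<phi>\<close> need not be injective and
    \<open>\<tau>\<close> is merely a choice of preimages. By \<open>dist\<close>, paths agree at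
    parameters with the same \<open>\<phi>\<close>.\<close>
  have "\<exists>t. 0 \<le> t \<and> t \<le> 1 \<and> \<phi> t = s" if "s \<in> {0..mdist m x y}" for s
    using that assms g cont by (intro IVT') (auto simp: \<phi>_def mdist_self)
  then obtain \<tau> where \<tau>: "\<And>s. s \<in> {0..mdist m x y} \<Longrightarrow> 0 \<le> \<tau> s \<and> \<tau> s \<le> 1 \<and> \<phi> (\<tau> s) = s"
    by metis
  have d: "mdist m (g (\<tau> s)) (g (\<tau> t)) = \<bar>s - t\<bar>" if st: "s \<in> {0..mdist m x y}" "t \<in> {0..mdist m x y}" for s t
  proof (cases "\<tau> s \<le> \<tau> t")
    case True
    then show ?thesis using dist[of "\<tau> s" "\<tau> t"] \<tau>[OF st(1)] \<tau>[OF st(2)] mdist_nonneg[of m "g (\<tau> s)" "g (\<tau> t)"]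
      by linarith
  next
    case False
    then show ?thesis using dist[of "\<tau> t" "\<tau> s"] \<tau>[OF st(1)] \<tau>[OF st(2)] mdist_nonneg[of m "g (\<tau> t)" "g (\<tau> s)"]
        mdist_commute[of m "g (\<tau> t)" "g (\<tau> s)"]
      by linarith
  qed
  let ?D = "mdist m x y"
  have M: "g (\<tau> s) \<in> mspace m" if "s \<in> {0..?D}" for s
    using gM \<tau>[OF that] by simp
  have e0: "g (\<tau> 0) = x"
    using \<tau>[of 0] M[of 0] assms by (simp add: \<phi>_def)
  have "mdist m (g (\<tau> ?D)) y = 0"
    using tri[of "\<tau> ?D" "\<tau> ?D"] \<tau>[of ?D] M[of ?D] mdist_nonneg[of m "g (\<tau> ?D)" y] by (simp add: mdist_self)
  then have "g (\<tau> ?D) = y"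
    using M[of ?D] assms by simp
  then have "geodesic_seg m x y (g \<circ> \<tau>)"
    using e0 d M by (simp add: geodesic_seg_def)
  then show ?thesis by blast
qed

section \<open>Non-contractible loops in metric graphs\<close>

text \<open>The kernel of \<open>exp\<close> consists of the integer multiples of 2 pi i, a discrete
  set; 1 is a crude lower bound for its gaps.\<close>

lemma constant_on_exp_eq_1:
  fixes k :: "'a::topological_space \<Rightarrow> complex"
  assumes "connected S" "continuous_on S k" "\<And>x. x \<in> S \<Longrightarrow> exp (k x) = 1"
  shows "k constant_on S"
proof (rule continuous_discrete_range_constant[OF assms(1,2)])
  fix x assume x: "x \<in> S"
  have "1 \<le> norm (k y - k x)" if y: "y \<in> S" "k y \<noteq> k x" for y
  proof -
    obtain i j :: int where ij: "Im (k x) = of_int (2 * i) * pi" "Im (k y) = of_int (2 * j) * pi" "Re (k x) = 0" "Re (k y) = 0"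
      using assms(3)[OF x] assms(3)[OF y(1)] unfolding exp_eq_1 by blast
    then have "i \<noteq> j"
      using y(2) by (auto simp: complex_eq_iff)
    then have "1 \<le> \<bar>real_of_int (j - i)\<bar>"
      by linarith
    then have "1 * 1 \<le> \<bar>real_of_int (j - i)\<bar> * (2 * pi)"
      using pi_gt3 by (intro mult_mono) auto
    also have "\<dots> = \<bar>Im (k y - k x)\<bar>"
    proof -
      have "Im (k y - k x) = real_of_int (j - i) * (2 * pi)"
        using ij by (simp add: algebra_simps)
      then show ?thesis by (simp add: abs_mult)
    qed
    also have "\<dots> \<le> norm (k y - k x)"
      by (rule abs_Im_le_cmod)
    finally show ?thesis by simp
  qed
  then show "\<exists>e>0. \<forall>y. y \<in> S \<and> k y \<noteq> k x \<longrightarrow> e \<le> norm (k y - k x)"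
    by (intro exI[of _ 1]) auto
qed

text \<open>Winding numbers by hand. A logarithm of \<open>f \<circ> h\<close> on the square changes
  along each intermediate loop by an amount independent of the homotopy time. That amount is 0 at
  the constant end, but at the other end \<open>\<rho>\<close> shows it to be 2 pi i.\<close>

lemma not_contractible_loop_degree_one:
  fixes f :: "'a \<Rightarrow> complex"
  assumes f: "continuous_map (mtopology_of m) (top_of_set (-{0})) f"
    and \<rho>: "continuous_on {0..1} \<rho>" "\<rho> 0 = 0" "\<rho> 1 = (1::real)"
    and fg: "\<And>u. u \<in> {0..1} \<Longrightarrow> f (g u) = exp (2 * of_real pi * \<i> * of_real (\<rho> u))"
  shows "\<not> contractible_loop m g"
proof
  assume "contractible_loop m g"
  then obtain a where "homotopic_with (\<lambda>h. h 0 = h 1) (top_of_set {0..1::real}) (mtopology_of m) g (\<lambda>_. a)"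
    unfolding contractible_loop_def by blast
  then obtain h where h: "continuous_map (prod_topology (top_of_set {0..1::real}) (top_of_set {0..1::real})) (mtopology_of m) h"
    "\<And>u. h (0, u) = g u" "\<And>u. h (1, u) = a" and loop: "\<And>t. t \<in> {0..1} \<Longrightarrow> h (t, 0) = h (t, 1)"
    unfolding homotopic_with_def by blast
  have "continuous_map (top_of_set ({0..1} \<times> {0..1})) (top_of_set (-{0})) (f \<circ> h)"
    using continuous_map_compose[OF h(1) f] by simp
  then have F: "continuous_on ({0..1} \<times> {0..1}) (f \<circ> h)" "\<And>p. p \<in> {0..1} \<times> {0..1} \<Longrightarrow> (f \<circ> h) p \<noteq> 0"
    by auto
  have "contractible ({0..1::real} \<times> {0..1::real})"
    by (intro convex_imp_contractible convex_Times) auto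
  then obtain \<theta> where \<theta>: "continuous_on ({0..1} \<times> {0..1}) \<theta>" and exp\<theta>: "\<And>p. p \<in> {0..1} \<times> {0..1} \<Longrightarrow> (f \<circ> h) p = exp (\<theta> p)"
    using continuous_logarithm_on_contractible[OF F(1) _ F(2)] by blast
  have c1: "continuous_on {0..1} (\<lambda>t. \<theta> (t, u))" if "u \<in> {0..1}" for u
    using that by (intro continuous_on_compose2[OF \<theta>] continuous_intros) auto
  have c2: "continuous_on {0..1} (\<lambda>u. \<theta> (t, u))" if "t \<in> {0..1}" for t
    using that by (intro continuous_on_compose2[OF \<theta>] continuous_intros) auto
  have "(\<lambda>t. \<theta> (t, 1) - \<theta> (t, 0)) constant_on {0..1}"
  proof (rule constant_on_exp_eq_1)
    show "exp (\<theta> (t, 1) - \<theta> (t, 0)) = 1" if "t \<in> {0..1}" for t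
      using exp\<theta>[of "(t, 0)"] exp\<theta>[of "(t, 1)"] loop[OF that] that F(2)[of "(t, 0)"] by (simp add: exp_diff)
  qed (auto intro!: continuous_intros c1)
  moreover have "(\<lambda>u. \<theta> (1, u) - \<theta> (1, 0)) constant_on {0..1}"
  proof (rule constant_on_exp_eq_1)
    show "exp (\<theta> (1, u) - \<theta> (1, 0)) = 1" if "u \<in> {0..1}" for u
      using exp\<theta>[of "(1, 0)"] exp\<theta>[of "(1, u)"] that h(3) F(2)[of "(1, 0)"] by (simp add: exp_diff)
  qed (auto intro!: continuous_intros c2)
  moreover have "(\<lambda>u. \<theta> (0, u) - 2 * of_real pi * \<i> * of_real (\<rho> u)) constant_on {0..1}"
  proof (rule constant_on_exp_eq_1)
    show "exp (\<theta> (0, u) - 2 * of_real pi * \<i> * of_real (\<rho> u)) = 1" if "u \<in> {0..1}" for u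
      using exp\<theta>[of "(0, u)"] that h(2) fg[OF that] by (simp add: exp_diff)
  qed (auto intro!: continuous_intros c2 \<rho>)
  ultimately have C: "\<theta> (0, 1) - \<theta> (0, 0) = \<theta> (1, 1) - \<theta> (1, 0)"
    "\<theta> (1, 1) - \<theta> (1, 0) = \<theta> (1, 0) - \<theta> (1, 0)"
    "\<theta> (0, 1) - 2 * of_real pi * \<i> * of_real (\<rho> 1) = \<theta> (0, 0) - 2 * of_real pi * \<i> * of_real (\<rho> 0)"
    unfolding constant_on_def by (metis atLeastAtMost_iff order_refl zero_le_one)+
  have "2 * of_real pi * \<i> = \<theta> (0, 1) - \<theta> (0, 0)"
    using C(3) \<rho>(2,3) by (simp add: algebra_simps)
  also have "\<dots> = 0"
    using C(1,2) by simp
  finally show False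
    by simp
qed

text \<open>Inside an open edge a geodesic is a continuous injection between intervals, hence open.\<close>
lemma metric_graph_open_arc:
  assumes "metric_graph m" and ab: "a < b"
    and cM: "\<And>s. s \<in> {a..b} \<Longrightarrow> c s \<in> mspace m"
    and iso: "\<And>s t. s \<in> {a..b} \<Longrightarrow> t \<in> {a..b} \<Longrightarrow> mdist m (c s) (c t) = \<bar>s - t\<bar>"
  obtains t1 t2 where "a < t1" "t1 < t2" "t2 < b" "openin (mtopology_of m) (c ` {t1<..<t2})"
proof -
  from assms(1)[unfolded metric_graph_def, THEN conjunct2] obtain V and E :: "((real \<Rightarrow> 'a) \<times> real) set" where *: "finite V \<and> finite E \<and> V \<subseteq> mspace m \<and>
      (\<forall>(\<gamma>, L)\<in>E. 0 < L \<and> \<gamma> ` {0..L} \<subseteq> mspace m \<and> \<gamma> 0 \<in> V \<and> \<gamma> L \<in> V \<and>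
          inj_on \<gamma> {0..<L} \<and> inj_on \<gamma> {0<..L} \<and> \<gamma> ` {0<..<L} \<inter> V = {} \<and>
          (\<forall>s t. 0 \<le> s \<and> s \<le> t \<and> t \<le> L \<longrightarrow> curve_length m \<gamma> s t = ereal (t - s))) \<and>
      (\<forall>(\<gamma>, L)\<in>E. \<forall>(\<gamma>', L')\<in>E. (\<gamma>, L) \<noteq> (\<gamma>', L') \<longrightarrow>
          \<gamma> ` {0<..<L} \<inter> \<gamma>' ` {0<..<L'} = {}) \<and>
      mspace m = V \<union> (\<Union>(\<gamma>, L)\<in>E. \<gamma> ` {0..L})"
    by (elim exE) (rule that)
  note V = conjunct1[OF *] conjunct1[OF *[THEN conjunct2, THEN conjunct2]]
  note E = conjunct1[OF *[THEN conjunct2]]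
  note edge = conjunct1[OF *[THEN conjunct2, THEN conjunct2, THEN conjunct2]]
  note disj = conjunct1[OF *[THEN conjunct2, THEN conjunct2, THEN conjunct2, THEN conjunct2]]
  note M = conjunct2[OF *[THEN conjunct2, THEN conjunct2, THEN conjunct2, THEN conjunct2]]
  have EM: "\<gamma> ` {0..L} \<subseteq> mspace m" and EV: "\<gamma> 0 \<in> V \<and> \<gamma> L \<in> V" and inj: "inj_on \<gamma> {0..<L}"
    and disjV: "\<gamma> ` {0<..<L} \<inter> V = {}"
    and len: "0 \<le> s \<Longrightarrow> s \<le> t \<Longrightarrow> t \<le> L \<Longrightarrow> curve_length m \<gamma> s t = ereal (t - s)"
    if "(\<gamma>, L) \<in> E" for \<gamma> L s t
    using bspec[OF edge that] by simp_all
  have disjE: "\<gamma> ` {0<..<L} \<inter> \<gamma>' ` {0<..<L'} = {}"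
    if "(\<gamma>, L) \<in> E" "(\<gamma>', L') \<in> E" "(\<gamma>, L) \<noteq> (\<gamma>', L')" for \<gamma> L \<gamma>' L'
  proof -
    from bspec[OF disj that(1)]
    have "\<forall>(\<gamma>', L')\<in>E. (\<gamma>, L) \<noteq> (\<gamma>', L') \<longrightarrow> \<gamma> ` {0<..<L} \<inter> \<gamma>' ` {0<..<L'} = {}"
      by simp
    from bspec[OF this that(2)] show ?thesis
      using that(3) by simp
  qed
  have cinj: "inj_on c {a..b}"
    using iso by (intro inj_onI) (metis abs_eq_0 eq_iff_diff_eq_0 mdist_self cM)
  have ccont: "continuous_map (top_of_set {a..b}) (mtopology_of m) c"
    using cM iso by (intro continuous_map_nonexpansive) auto
  have Econt: "continuous_map (top_of_set {0..L}) (mtopology_of m) \<gamma>" if e: "(\<gamma>, L) \<in> E" for \<gamma> L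
  proof (rule continuous_map_nonexpansive)
    show "\<gamma> s \<in> mspace m" if "s \<in> {0..L}" for s
      using EM[OF e] that by blast
    have le: "mdist m (\<gamma> s) (\<gamma> t) \<le> t - s" if "0 \<le> s" "s \<le> t" "t \<le> L" for s t
      using curve_length_ge_mdist[OF that(2), of m \<gamma>] len[OF e that] by simp
    show "mdist m (\<gamma> s) (\<gamma> t) \<le> \<bar>s - t\<bar>" if "s \<in> {0..L}" "t \<in> {0..L}" for s t
      using le[of s t] le[of t s] that mdist_commute[of m "\<gamma> s" "\<gamma> t"] by (cases "s \<le> t") auto
  qed
  have closedV: "closedin (mtopology_of m) V"
    using V Metric_space.Hausdorff_space_mtopology[OF Metric_space_mspace_mdist]
    by (intro closedin_Hausdorff_finite) (auto simp: mtopology_of_def Metric_space.topspace_mtopology[OF Metric_space_mspace_mdist])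
  have "infinite ({a<..<b} - {t \<in> {a..b}. c t \<in> V})"
  proof -
    have "finite (c -` V \<inter> {a..b})"
      using V(1) cinj by (rule finite_vimage_IntI)
    moreover have "{t \<in> {a..b}. c t \<in> V} = c -` V \<inter> {a..b}"
      by blast
    ultimately show ?thesis
      using ab by (simp add: Diff_infinite_finite)
  qed
  \<comment> \<open>The injective curve \<open>c\<close> meets the finite set \<open>V\<close> at
    finitely many times only, so it passes through the interior of an edge.\<close>
  then obtain t0 where "t0 \<in> {a<..<b} - {t \<in> {a..b}. c t \<in> V}"
    using infinite_imp_nonempty by blast
  then have t0: "a < t0" "t0 < b" "c t0 \<notin> V"
    by auto
  moreover have "c t0 \<in> mspace m"
    using t0 by (intro cM) auto
  ultimately have "c t0 \<in> (\<Union>(\<gamma>, L)\<in>E. \<gamma> ` {0..L})"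
    unfolding M by blast
  then obtain \<gamma> L s0 where e: "(\<gamma>, L) \<in> E" and s0: "s0 \<in> {0..L}" "c t0 = \<gamma> s0"
    by auto
  have s0': "s0 \<in> {0<..<L}"
    using EV[OF e] s0 t0(3) by (cases "s0 = 0"; cases "s0 = L") auto
  have ginj: "inj_on \<gamma> {0<..<L}"
    using inj[OF e] by (rule inj_on_subset) auto
  \<comment> \<open>The complement of such a piece is closed: it consists of the vertices, the
    finitely many other closed edges and the rest of this edge.\<close>
  have openE: "openin (mtopology_of m) (\<gamma> ` O')" if O': "open O'" "O' \<subseteq> {0<..<L}" for O'
  proof -
    define C where "C = V \<union> (\<Union>(\<gamma>', L')\<in>E - {(\<gamma>, L)}. \<gamma>' ` {0..L'}) \<union> \<gamma> ` ({0..L} - O')"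
    have c1: "closedin (mtopology_of m) (\<Union>(\<gamma>', L')\<in>E - {(\<gamma>, L)}. \<gamma>' ` {0..L'})"
      using E by (intro closedin_Union) (auto intro!: closedin_image_compact[OF Econt])
    have "compact ({0..L} - O')"
      using O' by (simp add: compact_diff)
    moreover have "continuous_map (top_of_set ({0..L} - O')) (mtopology_of m) \<gamma>"
      using Econt[OF e] by (rule continuous_map_from_subtopology_mono) auto
    ultimately have "closedin (mtopology_of m) (\<gamma> ` ({0..L} - O'))"
      by (intro closedin_image_compact)
    then have "closedin (mtopology_of m) C"
      unfolding C_def using closedV c1 by (intro closedin_Un)
    then have "openin (mtopology_of m) (mspace m - C)"
      by (metis openin_diff openin_topspace topspace_mtopology_of)
    moreover have "mspace m - C = \<gamma> ` O'"
    proof (intro equalityI subsetI)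
      fix p assume p: "p \<in> mspace m - C"
      then obtain \<gamma>' L' s where s: "(\<gamma>', L') \<in> E" "s \<in> {0..L'}" "p = \<gamma>' s"
        using M by (auto simp: C_def)
      have "(\<gamma>', L') = (\<gamma>, L)"
        using p s unfolding C_def by blast
      then show "p \<in> \<gamma> ` O'"
        using p s unfolding C_def by blast
    next
      fix p assume "p \<in> \<gamma> ` O'"
      then obtain s where s: "s \<in> O'" "p = \<gamma> s" by blast
      then have sL: "s \<in> {0<..<L}" using O' by blast
      have pE: "p \<in> \<gamma> ` {0<..<L}" using s sL by blast
      have "p \<notin> V"
        using disjV[OF e] pE by blast
      have "p \<notin> \<gamma>' ` {0..L'}" if e': "(\<gamma>', L') \<in> E" "(\<gamma>', L') \<noteq> (\<gamma>, L)" for \<gamma>' L'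
      proof
        assume "p \<in> \<gamma>' ` {0..L'}"
        then obtain s' where s': "s' \<in> {0..L'}" "p = \<gamma>' s'" by blast
        then have "s' \<in> {0<..<L'}"
          using \<open>p \<notin> V\<close> EV[OF e'(1)] by (cases "s' = 0"; cases "s' = L'") auto
        then have "p \<in> \<gamma>' ` {0<..<L'}"
          using s' by blast
        then show False
          using disjE[OF e'(1) e e'(2)] pE by blast
      qed
      moreover have "p \<notin> \<gamma> ` ({0..L} - O')"
      proof
        assume "p \<in> \<gamma> ` ({0..L} - O')"
        then obtain s' where s': "s' \<in> {0..L}" "s' \<notin> O'" "p = \<gamma> s'" by blast
        then have "s' \<in> {0<..<L}"
          using \<open>p \<notin> V\<close> EV[OF e] by (cases "s' = 0"; cases "s' = L") auto
        then have "s' = s"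
          using inj_onD[OF ginj, of s' s] s s' sL by simp
        then show False using s s' by simp
      qed
      ultimately have "p \<notin> C"
        using \<open>p \<notin> V\<close> unfolding C_def by auto
      moreover have "p \<in> mspace m"
        using EM[OF e] pE by (auto simp: subset_iff)
      ultimately show "p \<in> mspace m - C" by blast
    qed
    ultimately show ?thesis by simp
  qed
  have "openin (top_of_set {a..b}) {t \<in> {a..b}. c t \<in> \<gamma> ` {0<..<L}}"
    using openin_continuous_map_preimage[OF ccont openE[of "{0<..<L}"]] by simp
  moreover have "t0 \<in> {t \<in> {a..b}. c t \<in> \<gamma> ` {0<..<L}}"
    using t0 s0 s0' by auto
  ultimately obtain \<epsilon> where \<epsilon>: "\<epsilon> > 0" "ball t0 \<epsilon> \<inter> {a..b} \<subseteq> {t \<in> {a..b}. c t \<in> \<gamma> ` {0<..<L}}"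
    unfolding openin_contains_ball by blast
  define \<delta> where "\<delta> = min \<epsilon> (min (t0 - a) (b - t0)) / 2"
  have \<delta>: "\<delta> > 0" "\<delta> < \<epsilon>" "\<delta> < t0 - a" "\<delta> < b - t0"
    using \<epsilon>(1) t0 by (auto simp: \<delta>_def)
  define t1 where "t1 = t0 - \<delta>"
  define t2 where "t2 = t0 + \<delta>"
  have t12: "a < t1" "t1 < t2" "t2 < b"
    using \<delta> by (auto simp: t1_def t2_def)
  have cE: "c t \<in> \<gamma> ` {0<..<L}" if "t \<in> {t1<..<t2}" for t
  proof -
    have "t \<in> ball t0 \<epsilon> \<inter> {a..b}"
      using that \<delta> by (auto simp: t1_def t2_def dist_real_def)
    then show ?thesis using \<epsilon>(2) by blast
  qed
  \<comment> \<open>The coordinate of the geodesic along the edge. Invariance of domain makes its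
    image an open set of parameters, to which \<open>openE\<close> applies.\<close>
  define \<phi> where "\<phi> t = inv_into {0<..<L} \<gamma> (c t)" for t
  have \<phi>: "\<phi> t \<in> {0<..<L}" "\<gamma> (\<phi> t) = c t" if "t \<in> {t1<..<t2}" for t
    unfolding \<phi>_def using cE[OF that] by (rule inv_into_into, rule f_inv_into_f)
  have "continuous_on {t1<..<t2} \<phi>"
  proof (subst continuous_on_open_vimage, simp, intro allI impI)
    fix B :: "real set" assume "open B"
    have "openin (mtopology_of m) (\<gamma> ` (B \<inter> {0<..<L}))"
      using \<open>open B\<close> by (intro openE) auto
    moreover have "continuous_map (top_of_set {t1<..<t2}) (mtopology_of m) c"
      using ccont by (rule continuous_map_from_subtopology_mono) (use t12 in auto)
    ultimately have "openin (top_of_set {t1<..<t2}) {t \<in> {t1<..<t2}. c t \<in> \<gamma> ` (B \<inter> {0<..<L})}"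
      using openin_continuous_map_preimage by fastforce
    then have "open {t \<in> {t1<..<t2}. c t \<in> \<gamma> ` (B \<inter> {0<..<L})}"
      by (rule openin_open_trans) simp
    moreover have "{t \<in> {t1<..<t2}. c t \<in> \<gamma> ` (B \<inter> {0<..<L})} = \<phi> -` B \<inter> {t1<..<t2}"
    proof -
      have "c t \<in> \<gamma> ` (B \<inter> {0<..<L}) \<longleftrightarrow> \<phi> t \<in> B" if t: "t \<in> {t1<..<t2}" for t
      proof
        assume "c t \<in> \<gamma> ` (B \<inter> {0<..<L})"
        then obtain s where s: "s \<in> B" "s \<in> {0<..<L}" "c t = \<gamma> s" by blast
        then have "\<phi> t = s"
          using inj_onD[OF ginj, of "\<phi> t" s] \<phi>[OF t] by simp
        then show "\<phi> t \<in> B" using s by simp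
      next
        assume "\<phi> t \<in> B"
        then show "c t \<in> \<gamma> ` (B \<inter> {0<..<L})"
          using \<phi>[OF t] by (metis IntI imageI)
      qed
      then show ?thesis by auto
    qed
    ultimately show "open (\<phi> -` B \<inter> {t1<..<t2})" by simp
  qed
  moreover have "inj_on \<phi> {t1<..<t2}"
  proof (rule inj_onI)
    fix s t assume st: "s \<in> {t1<..<t2}" "t \<in> {t1<..<t2}" "\<phi> s = \<phi> t"
    then have "c s = c t"
      using \<phi>(2) by metis
    then show "s = t"
      using inj_onD[OF cinj, of s t] st t12 by simp
  qed
  ultimately have "open (\<phi> ` {t1<..<t2})"
    by (intro invariance_of_domain) auto
  then have "openin (mtopology_of m) (\<gamma> ` \<phi> ` {t1<..<t2})"
    using \<phi>(1) by (intro openE) auto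
  moreover have "\<gamma> ` \<phi> ` {t1<..<t2} = c ` {t1<..<t2}"
    unfolding image_image using \<phi>(2) by (rule image_cong[OF refl])
  ultimately show thesis
    using that t12 by simp
qed

text \<open>If part of the first side avoids the other two, collapsing the complement of a small arc
  of it maps the graph to the circle and the perimeter to a loop of degree one.\<close>
lemma metric_graph_triangle:
  assumes graph: "metric_graph m"
    and M: "x \<in> mspace m" "y \<in> mspace m" "z \<in> mspace m"
    and c1: "geodesic_seg m x y c1" and c2: "geodesic_seg m y z c2" and c3: "geodesic_seg m z x c3"
    and short: "ereal (mdist m x y + mdist m y z + mdist m z x) < shortest_noncontractible_loop m"
  shows "c1 ` {0..mdist m x y} \<subseteq> c2 ` {0..mdist m y z} \<union> c3 ` {0..mdist m z x}"
proof (rule ccontr)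
  define D1 where "D1 = mdist m x y"
  define D2 where "D2 = mdist m y z"
  define D3 where "D3 = mdist m z x"
  define P where "P = D1 + D2 + D3"
  define C where "C = c2 ` {0..D2} \<union> c3 ` {0..D3}"
  note D = D1_def D2_def D3_def
  have D0: "0 \<le> D1" "0 \<le> D2" "0 \<le> D3" by (simp_all add: D)
  note c1D = geodesic_segD[OF c1, folded D1_def]
  note c2D = geodesic_segD[OF c2, folded D2_def]
  note c3D = geodesic_segD[OF c3, folded D3_def]
  assume "\<not> c1 ` {0..mdist m x y} \<subseteq> c2 ` {0..mdist m y z} \<union> c3 ` {0..mdist m z x}"
  then obtain s0 where s0: "s0 \<in> {0..D1}" "c1 s0 \<notin> C"
    unfolding C_def D by blast
  have "x = c3 D3" "y = c2 0"
    using c2D(1) c3D(2) by auto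
  then have "x \<in> C" "y \<in> C"
    using D0 by (auto simp: C_def)
  then have s0': "0 < s0" "s0 < D1"
    using s0 c1D(1,2) by (metis atLeastAtMost_iff less_eq_real_def)+
  have "closedin (mtopology_of m) C"
    unfolding C_def D using closedin_geodesic[OF c2] closedin_geodesic[OF c3] by (rule closedin_Un)
  then have "openin (mtopology_of m) (mspace m - C)"
    by (metis openin_diff openin_topspace topspace_mtopology_of)
  then have "openin (top_of_set {0..D1}) {s \<in> {0..D1}. c1 s \<in> mspace m - C}"
    using openin_continuous_map_preimage[OF continuous_map_geodesic[OF c1, folded D1_def]] by fastforce
  moreover have "s0 \<in> {s \<in> {0..D1}. c1 s \<in> mspace m - C}"
    using s0 c1D(3) by blast
  ultimately obtain \<epsilon> where \<epsilon>: "\<epsilon> > 0" "ball s0 \<epsilon> \<inter> {0..D1} \<subseteq> {s \<in> {0..D1}. c1 s \<in> mspace m - C}"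
    unfolding openin_contains_ball by blast
  define \<delta> where "\<delta> = min \<epsilon> (min s0 (D1 - s0)) / 2"
  have \<delta>: "\<delta> > 0" "\<delta> < \<epsilon>" "\<delta> < s0" "\<delta> < D1 - s0"
    using \<epsilon>(1) s0' by (auto simp: \<delta>_def)
  have sub: "{s0 - \<delta>..s0 + \<delta>} \<subseteq> {0..D1}"
    using \<delta> by auto
  have notC: "c1 s \<notin> C" if "s \<in> {s0 - \<delta>..s0 + \<delta>}" for s
  proof -
    have "s \<in> ball s0 \<epsilon> \<inter> {0..D1}"
      using that \<delta> by (auto simp: dist_real_def)
    then show ?thesis using \<epsilon>(2) by blast
  qed
  \<comment> \<open>An arc of the first side away from the others could still meet branches of the
    graph; it is shrunk to one whose interior is open in the space.\<close>
  obtain t1 t2 where t12: "s0 - \<delta> < t1" "t1 < t2" "t2 < s0 + \<delta>" and arc: "openin (mtopology_of m) (c1 ` {t1<..<t2})"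
  proof (rule metric_graph_open_arc[OF graph, of "s0 - \<delta>" "s0 + \<delta>" c1])
    show "c1 s \<in> mspace m" if "s \<in> {s0 - \<delta>..s0 + \<delta>}" for s
      using that sub c1D(3) by blast
    show "mdist m (c1 s) (c1 t) = \<bar>s - t\<bar>" if "s \<in> {s0 - \<delta>..s0 + \<delta>}" "t \<in> {s0 - \<delta>..s0 + \<delta>}" for s t
      using that sub c1D(4) by blast
  qed (use \<delta> in auto)
  have t01: "{t1..t2} \<subseteq> {0..D1}" "0 < t1" "t2 < D1"
    using t12 \<delta> by auto
  have tC: "c1 s \<notin> C" if "s \<in> {t1..t2}" for s
    using that t12 by (intro notC) auto
  define A where "A = c1 ` {t1..t2}"
  \<comment> \<open>The arc is wrapped once around the unit circle and everything else goes to 1.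
    Along \<open>c1\<close> the distance from \<open>x\<close> is arc length, so the formula is
    continuous on the whole space.\<close>
  define f :: "'a \<Rightarrow> complex" where "f p = (if p \<in> A then exp (2 * of_real pi * \<i> * of_real ((mdist m x p - t1) / (t2 - t1))) else 1)" for p
  have closedA: "closedin (mtopology_of m) A"
    unfolding A_def
    by (intro closedin_image_compact continuous_map_from_subtopology_mono[OF continuous_map_geodesic[OF c1]] compact_Icc)
       (use t01 in \<open>simp_all add: D1_def\<close>)
  have fcont: "continuous_map (mtopology_of m) euclidean f"
    unfolding f_def
  proof (rule continuous_map_cases)
    have "continuous_map (mtopology_of m) euclidean
      ((\<lambda>u. exp (2 * of_real pi * \<i> * of_real ((u - t1) / (t2 - t1))) :: complex) \<circ> mdist m x)"
      by (rule continuous_map_compose[OF continuous_on_mdist[OF M(1)]])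
         (use t12 in \<open>auto intro!: continuous_intros\<close>)
    then show "continuous_map (subtopology (mtopology_of m) (mtopology_of m closure_of {p. p \<in> A})) euclidean
        (\<lambda>p. exp (2 * of_real pi * \<i> * of_real ((mdist m x p - t1) / (t2 - t1))))"
      by (intro continuous_map_from_subtopology) (simp add: o_def)
    fix p assume p: "p \<in> mtopology_of m frontier_of {p. p \<in> A}"
    have "p \<in> A"
      using p frontier_of_subset_closedin[OF closedA] by auto
    then obtain u where u: "u \<in> {t1..t2}" "p = c1 u"
      by (auto simp: A_def)
    \<comment> \<open>Openness of the arc leaves only its two end points in the frontier, and there
      both branches of \<open>f\<close> equal 1.\<close>
    have "c1 ` {t1<..<t2} \<subseteq> mtopology_of m interior_of A"
      using arc by (intro interior_of_maximal) (auto simp: A_def)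
    then have "p \<notin> c1 ` {t1<..<t2}"
      using p by (auto simp: frontier_of_def)
    then have "u = t1 \<or> u = t2"
      using u by (metis atLeastAtMost_iff greaterThanLessThan_iff imageI less_eq_real_def)
    moreover have "mdist m x p = u"
      using u t01 c1D(5) by blast
    ultimately show "exp (2 * of_real pi * \<i> * of_real ((mdist m x p - t1) / (t2 - t1))) = (1 :: complex)"
      using t12 by (auto simp: exp_two_pi_i)
  qed simp
  have f0: "f p \<noteq> 0" for p
    by (simp add: f_def)
  \<comment> \<open>The perimeter by arc length. It is 1-Lipschitz, so the loop has length at most
    \<open>P\<close>.\<close>
  define G where "G u = (if u \<le> D1 then c1 u else if u \<le> D1 + D2 then c2 (u - D1) else c3 (u - D1 - D2))" for u
  have GM: "G u \<in> mspace m" if "u \<in> {0..P}" for u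
    using that c1D(3)[of u] c2D(3)[of "u - D1"] c3D(3)[of "u - D1 - D2"] by (auto simp: G_def P_def)
  have G2: "G u = c2 (u - D1)" if "D1 \<le> u" "u \<le> D1 + D2" for u
    using that c1D(2) c2D(1) by (auto simp: G_def)
  have G3: "G u = c3 (u - D1 - D2)" if "D1 + D2 \<le> u" for u
  proof (cases "u = D1 + D2")
    case True
    then show ?thesis
      using G2[of u] D0 c2D(2) c3D(1) by simp
  qed (use that D0 in \<open>auto simp: G_def\<close>)
  have G1: "G u = c1 u" if "u \<le> D1" for u
    using that by (simp add: G_def)
  have Glip: "mdist m (G u) (G v) \<le> v - u" if uv: "0 \<le> u" "u \<le> v" "v \<le> P" for u v
  proof -
    have d1: "mdist m (G u) (G v) \<le> v - u" if "0 \<le> u" "u \<le> v" "v \<le> D1" for u v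
      using that c1D(4)[of u v] by (simp add: G1)
    have d2: "mdist m (G u) (G v) \<le> v - u" if "D1 \<le> u" "u \<le> v" "v \<le> D1 + D2" for u v
      using that c2D(4)[of "u - D1" "v - D1"] by (simp add: G2)
    have d3: "mdist m (G u) (G v) \<le> v - u" if "D1 + D2 \<le> u" "u \<le> v" "v \<le> P" for u v
      using that c3D(4)[of "u - D1 - D2" "v - D1 - D2"] by (simp add: G3 P_def)
    have tri: "mdist m (G u) (G v) \<le> mdist m (G u) (G t) + mdist m (G t) (G v)"
      if "u \<in> {0..P}" "t \<in> {0..P}" "v \<in> {0..P}" for u t v
      using that by (intro mdist_triangle GM)
    have d12: "mdist m (G u) (G v) \<le> v - u" if "0 \<le> u" "u \<le> v" "v \<le> D1 + D2" for u v
    proof (cases "v \<le> D1 \<or> D1 \<le> u")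
      case False
      then show ?thesis
        using tri[of u D1 v] d1[of u D1] d2[of D1 v] that D0 by (simp add: P_def)
    qed (use that d1[of u v] d2[of u v] in auto)
    show ?thesis
    proof (cases "v \<le> D1 + D2 \<or> D1 + D2 \<le> u")
      case False
      then show ?thesis
        using tri[of u "D1 + D2" v] d12[of u "D1 + D2"] d3[of "D1 + D2" v] uv D0 by (simp add: P_def)
    qed (use uv d12[of u v] d3[of u v] in auto)
  qed
  define g where "g u = G (P * u)" for u
  have P0: "P > 0"
    using D0 t01 t12 by (simp add: P_def)
  have Pu: "0 \<le> P * u" "P * u \<le> P" if "u \<in> {0..1}" for u
    using that P0 by (auto simp: mult_left_le)
  have Gcont: "continuous_map (top_of_set {0..P}) (mtopology_of m) G"
  proof (rule continuous_map_nonexpansive[OF GM])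
    show "mdist m (G s) (G t) \<le> \<bar>s - t\<bar>" if "s \<in> {0..P}" "t \<in> {0..P}" for s t
      using Glip[of s t] Glip[of t s] that mdist_commute[of m "G s" "G t"] by (cases "s \<le> t") auto
  qed
  have "continuous_map (top_of_set {0..1}) (top_of_set {0..P}) (\<lambda>u. P * u)"
    using Pu by (auto intro!: continuous_intros)
  from continuous_map_compose[OF this Gcont]
  have path: "is_path_in m g"
    by (simp add: is_path_in_def g_def[abs_def] o_def)
  have closed: "g 0 = g 1"
    using D0 c1D(1) c3D(2) G3[of P] by (simp add: g_def G1 P_def)
  \<comment> \<open>The angle of \<open>f\<close> along the loop in full turns: 0 before the arc,
    linear on it and 1 afterwards.\<close>
  define \<rho> where "\<rho> u = max 0 (min 1 ((P * u - t1) / (t2 - t1)))" for u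
  have "\<not> contractible_loop m g"
  proof (rule not_contractible_loop_degree_one)
    show "continuous_map (mtopology_of m) (top_of_set (- {0})) f"
      using fcont f0 by (auto simp: continuous_map_in_subtopology)
    show "continuous_on {0..1} \<rho>"
      unfolding \<rho>_def using t12 by (intro continuous_intros) auto
    show "\<rho> 0 = 0"
      using t01 t12 by (simp add: \<rho>_def divide_simps)
    have "1 \<le> (P - t1) / (t2 - t1)"
      using t01 t12 D0 by (simp add: P_def divide_simps)
    then show "\<rho> 1 = 1"
      by (simp add: \<rho>_def)
    fix u :: real assume u: "u \<in> {0..1}"
    define v where "v = P * u"
    have v: "0 \<le> v" "v \<le> P" "g u = G v" "\<rho> u = max 0 (min 1 ((v - t1) / (t2 - t1)))"
      using Pu[OF u] by (auto simp: v_def g_def \<rho>_def)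
    show "f (g u) = exp (2 * of_real pi * \<i> * of_real (\<rho> u))"
    proof (cases "v \<in> {t1..t2}")
      case True
      then have vD: "v \<in> {0..D1}"
        using t01 by blast
      then have "g u = c1 v" "mdist m x (c1 v) = v"
        using v(3) G1 c1D(5) by auto
      moreover have "c1 v \<in> A"
        using True by (simp add: A_def)
      moreover have "\<rho> u = (v - t1) / (t2 - t1)"
        using True t12 by (simp add: v(4))
      ultimately show ?thesis
        by (simp add: f_def)
    next
      case False
      \<comment> \<open>The first side does not return to its own arc, being injective, and the
        other sides lie in \<open>C\<close>, which misses the arc.\<close>
      have "G v \<notin> A"
      proof (cases "v \<le> D1")
        case True
        have "c1 v \<noteq> c1 w" if w: "w \<in> {t1..t2}" for w
        proof
          assume eq: "c1 v = c1 w"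
          have "v \<in> {0..D1}" "w \<in> {0..D1}"
            using True v w t01 by auto
          then have "v = w"
            using c1D(5)[of v] c1D(5)[of w] eq by metis
          then show False using False w by simp
        qed
        then show ?thesis
          unfolding A_def G1[OF True] by blast
      next
        case v1: False
        have "G v \<in> C"
        proof (cases "v \<le> D1 + D2")
          case True
          then have "G v = c2 (v - D1)" "v - D1 \<in> {0..D2}"
            using v1 G2[of v] by auto
          then show ?thesis by (simp add: C_def)
        next
          case False
          then have "G v = c3 (v - D1 - D2)" "v - D1 - D2 \<in> {0..D3}"
            using G3[of v] v(2) by (auto simp: P_def)
          then show ?thesis by (simp add: C_def)
        qed
        then show ?thesis
          using tC by (auto simp: A_def)
      qed
      then have "f (g u) = 1"
        by (simp add: f_def v(3))
      moreover have "\<rho> u = 0 \<or> \<rho> u = 1"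
        using False t12 by (auto simp: v(4) max_def min_def divide_simps)
      ultimately show ?thesis
        by (auto simp: exp_two_pi_i)
    qed
  qed
  then have "shortest_noncontractible_loop m \<le> curve_length m g 0 1"
    unfolding shortest_noncontractible_loop_def using path closed by (intro Inf_lower) blast
  also have "\<dots> \<le> ereal (P * (1 - 0))"
  proof (rule curve_length_le)
    fix s t :: real assume st: "0 \<le> s" "s \<le> t" "t \<le> 1"
    then have "P * s \<le> P * t" "0 \<le> P * s" "P * t \<le> P"
      using P0 by (auto simp: mult_left_le)
    then show "mdist m (g s) (g t) \<le> P * (t - s)"
      using Glip[of "P * s" "P * t"] by (simp add: g_def right_diff_distrib)
  qed
  finally show False
    using short by (simp add: P_def D)
qed

section \<open>Small balls in metric graphs\<close>

locale graph_with_long_loops =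
  fixes m :: "'a metric" and r :: real
  assumes graph: "metric_graph m" and r_pos: "0 < r"
    and loops: "4 * ereal r \<le> shortest_noncontractible_loop m"
begin

lemma geodesic_ex:
  assumes "x \<in> mspace m" "y \<in> mspace m"
  obtains \<gamma> where "geodesic_seg m x y \<gamma>"
proof -
  have "geodesic_space m"
    using graph by (simp add: metric_graph_def)
  from geodesic_space_geodesic_seg[OF this assms] show thesis
    using that by (elim exE)
qed

lemma triangle:
  assumes "x \<in> mspace m" "y \<in> mspace m" "z \<in> mspace m"
    and "geodesic_seg m x y c1" "geodesic_seg m y z c2" "geodesic_seg m z x c3"
    and "mdist m x y + mdist m y z + mdist m z x < 4 * r" and "s \<in> {0..mdist m x y}"
  shows "c1 s \<in> c2 ` {0..mdist m y z} \<union> c3 ` {0..mdist m z x}"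
proof -
  have "ereal (mdist m x y + mdist m y z + mdist m z x) < shortest_noncontractible_loop m"
    using assms(7) by (intro less_le_trans[OF _ loops]) simp
  from metric_graph_triangle[OF graph assms(1-6) this] show ?thesis
    using assms(8) by blast
qed

section \<open>Uniqueness, Gromov products and medians\<close>

text \<open>A bigon is a triangle with a constant side and perimeter below \<open>4 * r\<close>.
  Covering puts each point of one geodesic on the other, at the same parameter by distance from
  \<open>x\<close>.\<close>

lemma geodesic_unique:
  assumes "x \<in> mspace m" "y \<in> mspace m" "mdist m x y < 2 * r"
    and \<gamma>: "geodesic_seg m x y \<gamma>" "geodesic_seg m x y \<gamma>'" and s: "s \<in> {0..mdist m x y}"
  shows "\<gamma> s = \<gamma>' s"
proof -
  have "\<gamma> s \<in> (\<lambda>_. y) ` {0..mdist m y y} \<union> (\<lambda>s. \<gamma>' (mdist m x y - s)) ` {0..mdist m y x}"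
  proof (rule triangle[OF assms(1,2,2) \<gamma>(1) geodesic_seg_const[OF assms(2)] geodesic_seg_reverse[OF \<gamma>(2)] _ s])
    show "mdist m x y + mdist m y y + mdist m y x < 4 * r"
      using assms(2,3) by (simp add: mdist_self mdist_commute)
  qed
  then obtain u where u: "u \<in> {0..mdist m x y}" "\<gamma> s = \<gamma>' u"
  proof (elim UnE imageE)
    assume "\<gamma> s = y"
    then show thesis
      using that[of "mdist m x y"] geodesic_segD(2)[OF \<gamma>(2)] by simp
  next
    fix v assume "\<gamma> s = \<gamma>' (mdist m x y - v)" "v \<in> {0..mdist m y x}"
    then show thesis
      using that[of "mdist m x y - v"] by (simp add: mdist_commute)
  qed
  then have "s = u"
    using geodesic_segD(5)[OF \<gamma>(1) s] geodesic_segD(5)[OF \<gamma>(2) u(1)] by simp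
  then show ?thesis
    using u by simp
qed

lemma geodesic_initial:
  assumes "geodesic_seg m x y \<gamma>" "s \<in> {0..mdist m x y}"
  shows "geodesic_seg m x (\<gamma> s) \<gamma>"
  using geodesic_segD[OF assms(1)] assms(2) unfolding geodesic_seg_def by auto

text \<open>\<open>g\<close> is the Gromov product of \<open>x\<close> and \<open>y\<close> at \<open>w\<close>.\<close>
definition agree :: "'a \<Rightarrow> (real \<Rightarrow> 'a) \<Rightarrow> (real \<Rightarrow> 'a) \<Rightarrow> 'a \<Rightarrow> 'a \<Rightarrow> real \<Rightarrow> bool" where
  "agree w \<alpha> \<beta> x y g \<longleftrightarrow> 0 \<le> g \<and> g \<le> mdist m w x \<and> g \<le> mdist m w y \<and>
    (\<forall>s\<in>{0..g}. \<alpha> s = \<beta> s) \<and> mdist m x y = mdist m w x + mdist m w y - 2 * g"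

lemma agree_sym: "agree w \<alpha> \<beta> x y g \<Longrightarrow> agree w \<beta> \<alpha> y x g"
  by (auto simp: agree_def mdist_commute)

text \<open>The side from \<open>x\<close> to \<open>y\<close> is connected and covered by two
  closed sets, the sides at \<open>w\<close>, so some point of it lies on both. Its distance from
  \<open>w\<close> gives it equal parameters on them, uniqueness makes them coincide up to it, and
  it splits the distance from \<open>x\<close> to \<open>y\<close>.\<close>

lemma ex_agree:
  assumes M: "w \<in> mspace m" "x \<in> mspace m" "y \<in> mspace m" and near: "mdist m w x < r" "mdist m w y < r"
    and \<alpha>: "geodesic_seg m w x \<alpha>" and \<beta>: "geodesic_seg m w y \<beta>"
  obtains g where "agree w \<alpha> \<beta> x y g"
proof -
  obtain \<gamma> where \<gamma>: "geodesic_seg m x y \<gamma>"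
    using geodesic_ex M by blast
  let ?D = "mdist m x y"
  define A where "A = \<alpha> ` {0..mdist m w x}"
  define B where "B = \<beta> ` {0..mdist m w y}"
  have dxy: "?D < 2 * r"
    using mdist_triangle[of x m w y] M near by (simp add: mdist_commute)
  have cover: "\<gamma> s \<in> A \<union> B" if s: "s \<in> {0..?D}" for s
  proof -
    have "\<gamma> s \<in> (\<lambda>s. \<beta> (mdist m w y - s)) ` {0..mdist m y w} \<union> \<alpha> ` {0..mdist m w x}"
      using dxy near by (intro triangle[OF M(2,3,1) \<gamma> geodesic_seg_reverse[OF \<beta>] \<alpha> _ s]) (simp add: mdist_commute)
    moreover have "(\<lambda>s. \<beta> (mdist m w y - s)) ` {0..mdist m y w} \<subseteq> B"
      by (auto simp: B_def mdist_commute)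
    ultimately show ?thesis by (auto simp: A_def)
  qed
  have clo: "closed {s \<in> {0..?D}. \<gamma> s \<in> C}" if "closedin (mtopology_of m) C" for C
    using closedin_continuous_map_preimage[OF continuous_map_geodesic[OF \<gamma>] that]
    by (auto intro: closedin_closed_trans)
  have ends: "\<gamma> 0 \<in> A" "\<gamma> ?D \<in> B"
  proof -
    have "\<gamma> 0 = \<alpha> (mdist m w x)" "\<gamma> ?D = \<beta> (mdist m w y)"
      using geodesic_segD(1,2)[OF \<gamma>] geodesic_segD(2)[OF \<alpha>] geodesic_segD(2)[OF \<beta>] by simp_all
    then show "\<gamma> 0 \<in> A" "\<gamma> ?D \<in> B"
      unfolding A_def B_def by (metis atLeastAtMost_iff imageI mdist_nonneg order_refl)+
  qed
  have "\<exists>s\<in>{0..?D}. \<gamma> s \<in> A \<inter> B"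
  proof (rule ccontr)
    assume no: "\<not> (\<exists>s\<in>{0..?D}. \<gamma> s \<in> A \<inter> B)"
    let ?P = "{s \<in> {0..?D}. \<gamma> s \<in> A}" and ?Q = "{s \<in> {0..?D}. \<gamma> s \<in> B}"
    have "closed ?P" "closed ?Q"
      unfolding A_def B_def using clo closedin_geodesic[OF \<alpha>] closedin_geodesic[OF \<beta>] by blast+
    moreover have "{0..?D} \<subseteq> ?P \<union> ?Q" "?P \<inter> ?Q \<inter> {0..?D} = {}"
      using cover no by blast+
    moreover have "0 \<in> ?P \<inter> {0..?D}" "?D \<in> ?Q \<inter> {0..?D}"
      using ends by auto
    moreover have "connected {0..?D}" by simp
    ultimately show False
      unfolding connected_closed by blast
  qed
  then obtain s a b where s: "s \<in> {0..?D}" and a: "a \<in> {0..mdist m w x}" "\<gamma> s = \<alpha> a"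
    and b: "b \<in> {0..mdist m w y}" "\<gamma> s = \<beta> b"
    by (auto simp: A_def B_def)
  have ab: "a = b"
    using geodesic_segD(5)[OF \<alpha> a(1)] geodesic_segD(5)[OF \<beta> b(1)] a b by simp
  have p: "mdist m w (\<alpha> a) = a" "\<alpha> a \<in> mspace m"
    using geodesic_segD(5)[OF \<alpha> a(1)] geodesic_segD(3)[OF \<alpha> a(1)] by auto
  have eq: "\<alpha> u = \<beta> u" if "u \<in> {0..a}" for u
  proof (rule geodesic_unique[OF M(1) p(2)])
    show "geodesic_seg m w (\<alpha> a) \<alpha>"
      by (rule geodesic_initial[OF \<alpha> a(1)])
    show "geodesic_seg m w (\<alpha> a) \<beta>"
      using geodesic_initial[OF \<beta> b(1)] a b by simp
  qed (use p a near r_pos that in auto)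
  have "?D = mdist m x (\<gamma> s) + mdist m (\<gamma> s) y"
    using geodesic_segD(5,6)[OF \<gamma> s] by simp
  also have "mdist m x (\<gamma> s) = mdist m w x - a"
    using geodesic_segD(6)[OF \<alpha> a(1)] a(2) by (simp add: mdist_commute)
  also have "mdist m (\<gamma> s) y = mdist m w y - a"
    using geodesic_segD(6)[OF \<beta> b(1)] b(2) ab by simp
  finally have "agree w \<alpha> \<beta> x y a"
    unfolding agree_def using eq a b ab by auto
  then show thesis by (rule that)
qed

text \<open>A detour through a common point at distance \<open>h\<close> from \<open>w\<close>
  bounds the distance of \<open>x\<close> and \<open>y\<close>, and so forces the Gromov product to
  be at least \<open>h\<close>.\<close>

lemma agree_maximal:
  assumes M: "x \<in> mspace m" "y \<in> mspace m" and \<alpha>: "geodesic_seg m w x \<alpha>" and \<beta>: "geodesic_seg m w y \<beta>"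
    and g: "agree w \<alpha> \<beta> x y g" and h: "h \<in> {0..mdist m w x}" "h \<in> {0..mdist m w y}" "\<alpha> h = \<beta> h"
  shows "h \<le> g"
proof -
  have "mdist m x y \<le> mdist m x (\<alpha> h) + mdist m (\<alpha> h) y"
    using M geodesic_segD(3)[OF \<alpha> h(1)] by (intro mdist_triangle)
  also have "\<dots> = (mdist m w x - h) + (mdist m w y - h)"
    using geodesic_segD(6)[OF \<alpha> h(1)] geodesic_segD(6)[OF \<beta> h(2)] h(3) by (simp add: mdist_commute)
  finally show ?thesis
    using g by (simp add: agree_def)
qed

text \<open>The 0-hyperbolic inequality of trees: up to the smaller product \<open>\<alpha>\<close>
  and \<open>\<delta>\<close> both follow \<open>\<beta>\<close>, hence each other.\<close>

lemma agree_trans_le: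
  assumes M: "x \<in> mspace m" "z \<in> mspace m" and \<alpha>: "geodesic_seg m w x \<alpha>" and \<delta>: "geodesic_seg m w z \<delta>"
    and gxy: "agree w \<alpha> \<beta> x y gxy" and gyz: "agree w \<beta> \<delta> y z gyz" and gxz: "agree w \<alpha> \<delta> x z gxz"
  shows "min gxy gyz \<le> gxz"
proof (rule agree_maximal[OF M \<alpha> \<delta> gxz])
  show "min gxy gyz \<in> {0..mdist m w x}" "min gxy gyz \<in> {0..mdist m w z}"
    using gxy gyz by (auto simp: agree_def)
  have "min gxy gyz \<in> {0..gxy}" "min gxy gyz \<in> {0..gyz}"
    using gxy gyz by (auto simp: agree_def)
  then show "\<alpha> (min gxy gyz) = \<delta> (min gxy gyz)"
    using gxy gyz unfolding agree_def by metis
qed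

text \<open>The branch point of the tripod spanned by three points.\<close>

definition median :: "'a \<Rightarrow> 'a \<Rightarrow> 'a \<Rightarrow> 'a \<Rightarrow> bool" where
  "median p x y z \<longleftrightarrow> p \<in> mspace m \<and> mdist m x p + mdist m p y = mdist m x y \<and>
    mdist m y p + mdist m p z = mdist m y z \<and> mdist m z p + mdist m p x = mdist m z x"

lemma median_rotate: "median p x y z \<Longrightarrow> median p y z x"
  by (auto simp: median_def)

text \<open>By the 0-hyperbolic inequality the two smaller Gromov products are equal. So the branch
  point of the pair with the largest product lies beyond the place where the third geodesic leaves,
  and is between every two of the points.\<close>

lemma median_of_max:
  assumes M: "x \<in> mspace m" "y \<in> mspace m" "z \<in> mspace m"
    and geo: "geodesic_seg m w x \<alpha>" "geodesic_seg m w y \<beta>" "geodesic_seg m w z \<delta>"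
    and gxy: "agree w \<alpha> \<beta> x y gxy" and gyz: "agree w \<beta> \<delta> y z gyz" and gzx: "agree w \<delta> \<alpha> z x gzx"
    and max: "gyz \<le> gxy" "gzx \<le> gxy"
  shows "median (\<alpha> gxy) x y z"
proof -
  let ?p = "\<alpha> gxy"
  have I: "gxy \<in> {0..mdist m w x}" "gxy \<in> {0..mdist m w y}" "gzx \<in> {0..mdist m w x}" "gzx \<in> {0..mdist m w z}"
    using gxy gzx by (auto simp: agree_def)
  have p: "?p \<in> mspace m"
    using geodesic_segD(3)[OF geo(1) I(1)] .
  have "min gxy gyz \<le> gzx"
    using agree_trans_le[OF M(1,3) geo(1,3) gxy gyz agree_sym[OF gzx]] .
  moreover have "min gzx gxy \<le> gyz"
    using agree_trans_le[OF M(3,2) geo(3,2) gzx gxy agree_sym[OF gyz]] .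
  ultimately have eq: "gyz = gzx"
    using max by linarith
  have "?p = \<beta> gxy"
    using gxy by (auto simp: agree_def)
  then have px: "mdist m x ?p = mdist m w x - gxy" and py: "mdist m ?p y = mdist m w y - gxy"
    using geodesic_segD(6)[OF geo(1) I(1)] geodesic_segD(6)[OF geo(2) I(2)] by (simp_all add: mdist_commute)
  have "\<alpha> gzx = \<delta> gzx"
    using gzx unfolding agree_def by (metis atLeastAtMost_iff order_refl)
  then have "mdist m (\<alpha> gzx) z = mdist m w z - gzx"
    using geodesic_segD(6)[OF geo(3) I(4)] by simp
  moreover have "mdist m ?p z \<le> mdist m ?p (\<alpha> gzx) + mdist m (\<alpha> gzx) z"
    using p geodesic_segD(3)[OF geo(1) I(3)] M by (intro mdist_triangle)
  moreover have "mdist m ?p (\<alpha> gzx) = gxy - gzx"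
    using geodesic_segD(4)[OF geo(1) I(1,3)] max by simp
  ultimately have pz: "mdist m ?p z \<le> gxy - gzx + mdist m w z - gzx"
    by simp
  have "mdist m x y = mdist m w x + mdist m w y - 2 * gxy" "mdist m y z = mdist m w y + mdist m w z - 2 * gzx"
    "mdist m z x = mdist m w z + mdist m w x - 2 * gzx"
    using gxy gyz gzx eq by (auto simp: agree_def)
  moreover have "mdist m y z \<le> mdist m y ?p + mdist m ?p z" "mdist m z x \<le> mdist m z ?p + mdist m ?p x"
    using p M by (auto intro: mdist_triangle)
  ultimately show ?thesis
    unfolding median_def using p px py pz
    by (simp add: mdist_commute[of m ?p x] mdist_commute[of m y ?p] mdist_commute[of m z ?p])
qed

lemma ex_median:
  assumes M: "w \<in> mspace m" "x \<in> mspace m" "y \<in> mspace m" "z \<in> mspace m"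
    and near: "mdist m w x < r" "mdist m w y < r" "mdist m w z < r"
  obtains p where "median p x y z"
proof -
  obtain \<alpha> \<beta> \<delta> where geo: "geodesic_seg m w x \<alpha>" "geodesic_seg m w y \<beta>" "geodesic_seg m w z \<delta>"
    using geodesic_ex M by metis
  obtain gxy where gxy: "agree w \<alpha> \<beta> x y gxy"
    using ex_agree[OF M(1,2,3) near(1,2) geo(1,2)] .
  obtain gyz where gyz: "agree w \<beta> \<delta> y z gyz"
    using ex_agree[OF M(1,3,4) near(2,3) geo(2,3)] .
  obtain gzx where gzx: "agree w \<delta> \<alpha> z x gzx"
    using ex_agree[OF M(1,4,2) near(3,1) geo(3,1)] .
  consider "gyz \<le> gxy \<and> gzx \<le> gxy" | "gzx \<le> gyz \<and> gxy \<le> gyz" | "gxy \<le> gzx \<and> gyz \<le> gzx"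
    by linarith
  then show thesis
  proof cases
    case 1
    then show thesis
      using median_of_max[OF M(2,3,4) geo gxy gyz gzx] that by blast
  next
    case 2
    then have "median (\<beta> gyz) y z x"
      using median_of_max[OF M(3,4,2) geo(2,3,1) gyz gzx gxy] by blast
    then show thesis
      using median_rotate that by blast
  next
    case 3
    then have "median (\<delta> gzx) z x y"
      using median_of_max[OF M(4,2,3) geo(3,1,2) gzx gxy gyz] by blast
    then show thesis
      using median_rotate that by blast
  qed
qed

text \<open>The degenerate triangle \<open>x\<close>, \<open>y\<close>, \<open>p\<close> has
  perimeter twice the distance of \<open>x\<close> and \<open>y\<close>, below \<open>4 * r\<close>.
  Its other sides therefore cover \<open>\<gamma>\<close>, and at distance
  \<open>mdist m x p\<close> from \<open>x\<close> they contain only \<open>p\<close>.\<close>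

lemma geodesic_through:
  assumes M: "x \<in> mspace m" "y \<in> mspace m" "p \<in> mspace m" and d: "mdist m x y < 2 * r"
    and \<gamma>: "geodesic_seg m x y \<gamma>" and p: "mdist m x p + mdist m p y = mdist m x y"
  shows "\<gamma> (mdist m x p) = p"
proof -
  let ?g = "mdist m x p"
  have g: "?g \<in> {0..mdist m x y}"
    unfolding atLeastAtMost_iff using p mdist_nonneg[of m p y] mdist_nonneg[of m x p] by linarith
  obtain \<alpha> \<beta> where \<alpha>: "geodesic_seg m x p \<alpha>" and \<beta>: "geodesic_seg m p y \<beta>"
    using geodesic_ex M by metis
  have "\<gamma> ?g \<in> (\<lambda>s. \<beta> (mdist m p y - s)) ` {0..mdist m y p} \<union> (\<lambda>s. \<alpha> (mdist m x p - s)) ` {0..mdist m p x}"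
    using d p by (intro triangle[OF M \<gamma> geodesic_seg_reverse[OF \<beta>] geodesic_seg_reverse[OF \<alpha>] _ g])
      (simp add: mdist_commute[of m y p] mdist_commute[of m p x])
  then consider u where "u \<in> {0..mdist m p y}" "\<gamma> ?g = \<beta> u" | u where "u \<in> {0..?g}" "\<gamma> ?g = \<alpha> u"
  proof (elim UnE imageE)
    fix s assume "\<gamma> ?g = \<beta> (mdist m p y - s)" "s \<in> {0..mdist m y p}"
    then show ?thesis using that(1)[of "mdist m p y - s"] by (simp add: mdist_commute)
  next
    fix s assume "\<gamma> ?g = \<alpha> (mdist m x p - s)" "s \<in> {0..mdist m p x}"
    then show ?thesis using that(2)[of "mdist m x p - s"] by (simp add: mdist_commute)
  qed
  then show ?thesis
  proof cases
    case 1
    have "mdist m p y - u = mdist m x y - ?g"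
      using geodesic_segD(6)[OF \<beta> 1(1)] geodesic_segD(6)[OF \<gamma> g] 1(2) by simp
    then have "u = 0" using p by simp
    then show ?thesis using 1 geodesic_segD(1)[OF \<beta>] by simp
  next
    case 2
    have "u = ?g"
      using geodesic_segD(5)[OF \<alpha> 2(1)] geodesic_segD(5)[OF \<gamma> g] 2(2) by simp
    then show ?thesis using 2 geodesic_segD(2)[OF \<alpha>] by simp
  qed
qed

text \<open>The geodesics from \<open>z\<close> form a tripod with stem of length \<open>g\<close>
  and legs \<open>k\<close>, \<open>l\<close>, where \<open>k + l\<close> is the distance of
  \<open>a\<close> and \<open>b\<close>. If either moving point is on the stem, both lie on one
  geodesic and are at most \<open>\<bar>k - l\<bar>\<close> apart; otherwise the path through the
  branch point is no longer than the two legs.\<close>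

lemma contraction_ball:
  assumes M: "w \<in> mspace m" "z \<in> mspace m" "a \<in> mspace m" "b \<in> mspace m"
    and near: "mdist m w z < r" "mdist m w a < r" "mdist m w b < r"
    and \<gamma>: "geodesic_seg m z a \<gamma>" and \<gamma>': "geodesic_seg m z b \<gamma>'" and t: "t \<in> {0..1}"
  shows "mdist m (\<gamma> (t * mdist m z a)) (\<gamma>' (t * mdist m z b)) \<le> mdist m a b"
proof -
  obtain p where p: "median p a z b"
    using ex_median[OF M(1,3,2,4) near(2,1,3)] .
  define g where "g = mdist m z p"
  define k where "k = mdist m p a"
  define l where "l = mdist m p b"
  have pM: "p \<in> mspace m" and za: "mdist m z a = g + k" and zb: "mdist m z b = g + l" and ab: "mdist m a b = k + l"
    using p by (auto simp: median_def g_def k_def l_def mdist_commute add.commute)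
  have nn: "0 \<le> g" "0 \<le> k" "0 \<le> l" by (simp_all add: g_def k_def l_def)
  have d: "mdist m z a < 2 * r" "mdist m z b < 2 * r"
    using mdist_triangle[of z m w a] mdist_triangle[of z m w b] M near by (simp_all add: mdist_commute)
  have \<gamma>p: "\<gamma> g = p" "\<gamma>' g = p"
    using geodesic_through[OF M(2,3) pM d(1) \<gamma>] geodesic_through[OF M(2,4) pM d(2) \<gamma>'] za zb
    by (simp_all add: g_def k_def l_def)
  have gI: "g \<in> {0..mdist m z a}" "g \<in> {0..mdist m z b}"
    using nn za zb by auto
  have same: "\<gamma> u = \<gamma>' u" if "u \<in> {0..g}" for u
  proof (rule geodesic_unique[OF M(2) pM])
    show "geodesic_seg m z p \<gamma>" "geodesic_seg m z p \<gamma>'"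
      using geodesic_initial[OF \<gamma> gI(1)] geodesic_initial[OF \<gamma>' gI(2)] \<gamma>p by auto
    show "mdist m z p < 2 * r"
      using d(1) za nn by (simp add: g_def)
    show "u \<in> {0..mdist m z p}"
      using that by (simp add: g_def)
  qed
  define s where "s = t * mdist m z a"
  define s' where "s' = t * mdist m z b"
  have sI: "s \<in> {0..mdist m z a}" "s' \<in> {0..mdist m z b}"
    using t by (auto simp: s_def s'_def mult_left_le_one_le)
  have diff: "\<bar>s - s'\<bar> \<le> k + l"
  proof -
    have "s - s' = t * (k - l)"
      by (simp add: s_def s'_def za zb algebra_simps)
    then have "\<bar>s - s'\<bar> = t * \<bar>k - l\<bar>"
      using t by (simp add: abs_mult)
    also have "\<dots> \<le> 1 * \<bar>k - l\<bar>"
      using t by (intro mult_right_mono) auto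
    also have "\<dots> \<le> k + l"
      using nn by simp
    finally show ?thesis .
  qed
  have "mdist m (\<gamma> s) (\<gamma>' s') \<le> k + l"
  proof -
    consider "s' \<le> g" | "s \<le> g" | "g \<le> s" "g \<le> s'" by linarith
    then show ?thesis
    proof cases
      case 1
      then have "mdist m (\<gamma> s) (\<gamma>' s') = mdist m (\<gamma> s) (\<gamma> s')"
        using same sI by simp
      also have "\<dots> = \<bar>s - s'\<bar>"
        using 1 sI gI by (intro geodesic_segD(4)[OF \<gamma>]) auto
      finally show ?thesis using diff by simp
    next
      case 2
      then have "mdist m (\<gamma> s) (\<gamma>' s') = mdist m (\<gamma>' s) (\<gamma>' s')"
        using same sI by simp
      also have "\<dots> = \<bar>s - s'\<bar>"
        using 2 sI gI by (intro geodesic_segD(4)[OF \<gamma>']) auto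
      finally show ?thesis using diff by simp
    next
      case 3
      have "mdist m (\<gamma> s) (\<gamma>' s') \<le> mdist m (\<gamma> s) (\<gamma> g) + mdist m (\<gamma>' g) (\<gamma>' s')"
        using mdist_triangle[of "\<gamma> s" m p "\<gamma>' s'"] pM geodesic_segD(3)[OF \<gamma> sI(1)] geodesic_segD(3)[OF \<gamma>' sI(2)] \<gamma>p
        by simp
      also have "\<dots> = (s - g) + (s' - g)"
        using 3 geodesic_segD(4)[OF \<gamma> sI(1) gI(1)] geodesic_segD(4)[OF \<gamma>' gI(2) sI(2)] by simp
      also have "\<dots> \<le> k + l"
        using sI za zb by simp
      finally show ?thesis .
    qed
  qed
  then show ?thesis
    by (simp add: s_def s'_def ab)
qed

text \<open>For ball convexity, a point on the geodesic from \<open>x\<close> to \<open>y\<close>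
  lies on a side of the triangle ending at \<open>u\<close>, so it is no farther from
  \<open>u\<close> than the other end of that side.\<close>

lemma convex_small_balls: "convex_small_balls m r"
proof
  show "0 < r" by (rule r_pos)
  show "\<exists>\<gamma>. geodesic_seg m x y \<gamma>" if "x \<in> mspace m" "y \<in> mspace m" for x y
    using geodesic_ex that by blast
  show "mdist m u (\<gamma> s) < r"
    if M: "u \<in> mspace m" "x \<in> mspace m" "y \<in> mspace m" and near: "mdist m u x < r" "mdist m u y < r"
      and \<gamma>: "geodesic_seg m x y \<gamma>" and s: "s \<in> {0..mdist m x y}" for u x y \<gamma> s
  proof -
    obtain \<alpha> \<beta> where \<alpha>: "geodesic_seg m u x \<alpha>" and \<beta>: "geodesic_seg m y u \<beta>"
      using geodesic_ex M by metis
    have "mdist m x y < 2 * r"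
      using mdist_triangle[of x m u y] M near by (simp add: mdist_commute)
    then have "\<gamma> s \<in> \<beta> ` {0..mdist m y u} \<union> \<alpha> ` {0..mdist m u x}"
      using near by (intro triangle[OF M(2,3,1) \<gamma> \<beta> \<alpha> _ s]) (simp add: mdist_commute)
    then consider v where "v \<in> {0..mdist m y u}" "\<gamma> s = \<beta> v" | v where "v \<in> {0..mdist m u x}" "\<gamma> s = \<alpha> v"
      by blast
    then show ?thesis
    proof cases
      case 1
      then have "mdist m u (\<gamma> s) = mdist m u y - v"
        using geodesic_segD(6)[OF \<beta> 1(1)] by (simp add: mdist_commute)
      then show ?thesis using 1 near by simp
    next
      case 2
      then show ?thesis using geodesic_segD(5)[OF \<alpha> 2(1)] near by simp
    qed
  qed
qed (rule contraction_ball)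

end

theorem mainTheorem13:
  fixes m :: "'a metric" and r :: real
  assumes "(metric_graph m \<and> 0 < r \<and> 4 * ereal r \<le> shortest_noncontractible_loop m) \<or>
           (geodesic_space m \<and> 0 < convexity_radius m \<and> 0 < r \<and> 2 * ereal r \<le> convexity_radius m)"
  shows "homotopy_equivalence_map (realization_topology (cech_complex m (r / 2)))
            (realization_topology (rips_complex m r)) id
       \<and> homotopy_equivalence_map (realization_topology (rips_complex m r))
            (realization_topology (cech_complex m r)) id"
proof -
  have "convex_small_balls m r"
    using assms
  proof
    assume "metric_graph m \<and> 0 < r \<and> 4 * ereal r \<le> shortest_noncontractible_loop m"
    then have "graph_with_long_loops m r"
      by (simp add: graph_with_long_loops_def)
    then show ?thesis
      by (rule graph_with_long_loops.convex_small_balls)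
  qed (use convex_small_balls_convexity_radius in blast)
  then show ?thesis
    using convex_small_balls.cech_rips_equivalence convex_small_balls.rips_cech_equivalence by blast
qed

end
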